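(* Let $\nu_0=n-\nu_1-\cdots-\nu_p$. Problem 2B (stated in the context) is solvable if and only if $$\dim\Big(\mathcal V^\star_g+\sum_{(i,j)\in P}\operatorname{span}_{\mathbb R}\widehat R_i(\lambda_{i,j})\Big)\ge\operatorname{card}P+\nu_0$$ and $$\dim\Big(\sum_{(i,j)\in P}\operatorname{span}_{\mathbb R}\widehat R_i(\lambda_{i,j})\Big)\ge\operatorname{card}P$$ for all $P$ in the power set $2^I$, where $I=\{(1,1),\ldots,(1,\nu_1),\ldots,(p,1),\ldots,(p,\nu_p)\}$.
   Context: System: $\Sigma=(A,B,C,D)$ is $\mathcal D x=Ax+Bu$, $y=Cx+Du$, $x(t)\in\mathbb R^n$, $u(t)\in\mathbb R^m$, $y(t)\in\mathbb R^p$, real matrices; $\mathcal D x=\dot x$ (continuous time) or $x(t+1)$ (discrete time). $\mathbb C_g$ is the open left half-plane (continuous) or open unit disc (discrete), $\mathbb R_g=\mathbb C_g\cap\mathbb R$. Invariant zeros of $\Sigma$ are those $\lambda\in\mathbb C$ at which the rank of $\begin{bmatrix}A-\lambda I&B\\C&D\end{bmatrix}$ is below its normal rank; minimum-phase zeros are those in $\mathbb C_g$. Standing assumptions: $\Sigma$ is right invertible (that matrix pencil has full row rank for all but finitely many $\lambda$), stabilizable, with no invariant zero at $0$ (continuous) or $1$ (discrete); algebraic and geometric multiplicities of each minimum-phase invariant zero coincide; no Jordan chains are allowed in the closed loop ($A+BF$ diagonalizable); in this part all closed-loop eigenvalues considered and all minimum-phase invariant zeros are real. Control: $u=Fx+Gr$,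 $F$ real with $\sigma(A+BF)\subset\mathbb C_g$, $G$ a right inverse of the closed-loop static gain. For constant $r$, $\epsilon=y-r$ satisfies $\mathcal D\xi=(A+BF)\xi$, $\epsilon=(C+DF)\xi$. State-to-output decoupling: for any initial condition, $\epsilon_i(t)=\sum_{j=1}^{\nu_i}\beta_{i,j}e^{\lambda_{i,j}t}$ (resp. $\sum_j\beta_{i,j}\lambda_{i,j}^t$), $i=1,\ldots,p$, where the $\lambda_{i,j}$ are the observable closed-loop eigenvalues and the coefficients $\beta_{i,j}$ can be made arbitrary by choice of $\xi(0)$. That is, $A+BF$ has a basis of eigenvectors $v_{0,1},\ldots,v_{0,\nu_0},v_{1,1},\ldots,v_{p,\nu_p}$ with eigenvalues $\lambda_{i,j}$ such that $(C+DF)v_{0,j}=0$ and $(C+DF)v_{i,j}$ is a nonzero multiple of the $i$-th canonical vector $e_i\in\mathbb R^p$ for $i\ge1$; the $\lambda_{i,j}$ ($1\le j\le\nu_i$) are the eigenvalues observable from $\epsilon_i$ and the $\lambda_{0,j}$ the unobservable ones (all counted with multiplicity). Problem 2B: given nonnegative integers $\nu_1,\ldots,\nu_p$ with $\nu_0=n-\sum_i\nu_i\ge0$, and assigned $\lambda_{i,j}\in\mathbb R_g$ ($i=1,\ldots,p$, $j=1,\ldots,\nu_i$), allowed to be minimum-phase invariant zeros, find $F,G$ such that: (1) $y(t)\to\bar r$ for every constant reference $r(t)=\bar r$; (2) state-to-output decoupling is achieved; (3) from each $\epsilon_i$ exactly $\nu_i$ eigenvalues are observable; and the eigenvalues observable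 from $\epsilon_i$ are exactly $\{\lambda_{i,j}\}_{j=1,\ldots,\nu_i}$, while the unobservable ones are not assigned a priori. Solvable means such $F,G$ exist. Sets: for real $\lambda$ and $i\in\{1,\ldots,p\}$, $\widehat R_i(\lambda)=\{v\in\mathbb R^n\mid\exists w\in\mathbb R^m,\ \exists\delta\in\mathbb R\setminus\{0\}:\ (A-\lambda I)v+Bw=0,\ Cv+Dw=\delta e_i\}$. $\mathcal V^\star_g$ is the largest stabilizability output-nulling subspace of $\Sigma$: the largest subspace $\mathcal V\subseteq\mathbb R^n$ for which there is a real $F$ with $(A+BF)\mathcal V\subseteq\mathcal V\subseteq\ker(C+DF)$ and $\sigma(A+BF|\mathcal V)\subset\mathbb C_g$. *)

theory Defs
  imports
    "HOL-Analysis.Analysis"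
    "HOL-Computational_Algebra.Computational_Algebra"
    "HOL-Computational_Algebra.Field_as_Ring"
    "HOL-Library.Set_Algebras"
begin

datatype time_domain = Continuous | Discrete

fun stable_region :: "time_domain \<Rightarrow> complex set" where
  "stable_region Continuous = {z. Re z < 0}"
| "stable_region Discrete = {z. norm z < 1}"

text \<open>The frequency of constant signals: \<open>\<D> x = dc_point \<cdot> x\<close> for constant \<open>x\<close>.\<close>

fun dc_point :: "time_domain \<Rightarrow> real" where
  "dc_point Continuous = 0"
| "dc_point Discrete = 1"

subsection \<open>Spectra\<close>

text \<open>The spectrum of the restriction of a real matrix to an \<open>M\<close>-invariant real subspace \<open>V\<close>:
  eigenvectors are sought in the complexification \<open>V + \<i> V\<close>.\<close>

definition spectrum_on :: "real^'n^'n \<Rightarrow> (real^'n) set \<Rightarrow> complex set" where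
  "spectrum_on M V = {z. \<exists>v :: complex^'n. v \<noteq> 0 \<and> (\<chi> i. Re (v $ i)) \<in> V \<and> (\<chi> i. Im (v $ i)) \<in> V \<and>
      (\<chi> i j. complex_of_real (M $ i $ j)) *v v = z *s v}"

definition spectrum :: "real^'n^'n \<Rightarrow> complex set" where
  "spectrum M = spectrum_on M UNIV"

subsection \<open>The system pencil and invariant zeros\<close>

definition system_pencil ::
  "real^'n^'n \<Rightarrow> real^'m^'n \<Rightarrow> real^'n^'p \<Rightarrow> real^'m^'p \<Rightarrow> complex poly^('n + 'm)^('n + 'p)" where
  "system_pencil A B C D = (\<chi> r c.
     case r of
       Inl i \<Rightarrow> (case c of Inl j \<Rightarrow> [:of_real (A $ i $ j), if i = j then -1 else 0:]
                         | Inr k \<Rightarrow> [:of_real (B $ i $ k):])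
     | Inr l \<Rightarrow> (case c of Inl j \<Rightarrow> [:of_real (C $ l $ j):]
                         | Inr k \<Rightarrow> [:of_real (D $ l $ k):]))"

definition eval_pmat :: "complex poly^'c^'r \<Rightarrow> complex \<Rightarrow> complex^'c^'r" where
  "eval_pmat P z = (\<chi> r c. poly (P $ r $ c) z)"

definition normal_rank :: "complex poly^'c^'r \<Rightarrow> nat" where
  "normal_rank P = Max (range (\<lambda>z. rank (eval_pmat P z)))"

definition invariant_zero ::
  "real^'n^'n \<Rightarrow> real^'m^'n \<Rightarrow> real^'n^'p \<Rightarrow> real^'m^'p \<Rightarrow> complex \<Rightarrow> bool" where
  "invariant_zero A B C D z \<longleftrightarrow>
     rank (eval_pmat (system_pencil A B C D) z) < normal_rank (system_pencil A B C D)"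

text \<open>The minors of order \<open>k\<close> by the Leibniz formula. Rows and columns are selected by injective
  enumerations; their order affects a minor only by its sign.\<close>

definition minors :: "nat \<Rightarrow> 'a::comm_ring_1^'c^'r \<Rightarrow> 'a set" where
  "minors k M = {(\<Sum>\<pi> | \<pi> permutes {..<k}. of_int (sign \<pi>) * (\<Prod>i<k. M $ \<rho> i $ \<gamma> (\<pi> i))) | \<rho> \<gamma>.
     inj_on \<rho> {..<k} \<and> inj_on \<gamma> {..<k}}"

text \<open>The invariant polynomials (the diagonal entries of the Smith form) as quotients of
  consecutive determinantal divisors, following Gantmacher.\<close>

definition determinantal_divisor :: "complex poly^'c^'r \<Rightarrow> nat \<Rightarrow> complex poly" where
  "determinantal_divisor P k = Gcd (minors k P)"

definition invariant_poly :: "complex poly^'c^'r \<Rightarrow> nat \<Rightarrow> complex poly" where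
  "invariant_poly P k = determinantal_divisor P k div determinantal_divisor P (k - 1)"

text \<open>The algebraic multiplicity of a zero is the degree of the product of the elementary
  divisors at \<open>z\<close>, i.e. of the powers of \<open>[:-z, 1:]\<close> in the invariant polynomials; its
  geometric multiplicity is the rank deficiency of the pencil at \<open>z\<close>.\<close>

definition zero_alg_mult :: "complex poly^'c^'r \<Rightarrow> complex \<Rightarrow> nat" where
  "zero_alg_mult P z = (\<Sum>k = 1..normal_rank P. order z (invariant_poly P k))"

definition zero_geom_mult :: "complex poly^'c^'r \<Rightarrow> complex \<Rightarrow> nat" where
  "zero_geom_mult P z = normal_rank P - rank (eval_pmat P z)"

definition right_invertible ::
  "real^'n^'n \<Rightarrow> real^'m^'n \<Rightarrow> real^'n^'p \<Rightarrow> real^'m^'p \<Rightarrow> bool" where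
  "right_invertible A B C D \<longleftrightarrow>
     finite {z. rank (eval_pmat (system_pencil A B C D) z) \<noteq> CARD('n) + CARD('p)}"

definition stabilizable :: "time_domain \<Rightarrow> real^'n^'n \<Rightarrow> real^'m^'n \<Rightarrow> bool" where
  "stabilizable td A B \<longleftrightarrow> (\<exists>F :: real^'n^'m. spectrum (A + B ** F) \<subseteq> stable_region td)"

subsection \<open>Subspaces\<close>

definition stabilizability_output_nulling ::
  "time_domain \<Rightarrow> real^'n^'n \<Rightarrow> real^'m^'n \<Rightarrow> real^'n^'p \<Rightarrow> real^'m^'p \<Rightarrow> (real^'n) set \<Rightarrow> bool" where
  "stabilizability_output_nulling td A B C D V \<longleftrightarrow> subspace V \<and>
     (\<exists>F :: real^'n^'m. (\<lambda>x. (A + B ** F) *v x) ` V \<subseteq> V \<and> V \<subseteq> {x. (C + D ** F) *v x = 0} \<and>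
        spectrum_on (A + B ** F) V \<subseteq> stable_region td)"

definition V_star_g ::
  "time_domain \<Rightarrow> real^'n^'n \<Rightarrow> real^'m^'n \<Rightarrow> real^'n^'p \<Rightarrow> real^'m^'p \<Rightarrow> (real^'n) set" where
  "V_star_g td A B C D = (GREATEST V. stabilizability_output_nulling td A B C D V)"

definition R_hat ::
  "real^'n^'n \<Rightarrow> real^'m^'n \<Rightarrow> real^'n^'p \<Rightarrow> real^'m^'p \<Rightarrow> 'p \<Rightarrow> real \<Rightarrow> (real^'n) set" where
  "R_hat A B C D i l = {v. \<exists>w :: real^'m. \<exists>\<delta>. \<delta> \<noteq> 0 \<and>
      (A - mat l) *v v + B *v w = 0 \<and> C *v v + D *v w = \<delta> *s axis i 1}"

subsection \<open>The tracking and decoupling problem\<close>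

definition closed_loop_gain ::
  "time_domain \<Rightarrow> real^'n^'n \<Rightarrow> real^'m^'n \<Rightarrow> real^'n^'p \<Rightarrow> real^'m^'p \<Rightarrow> real^'n^'m \<Rightarrow> real^'m^'p" where
  "closed_loop_gain td A B C D F =
     (C + D ** F) ** matrix_inv (mat (dc_point td) - (A + B ** F)) ** B + D"

text \<open>Asymptotic tracking of every constant reference \<open>r\<close>, from every initial state, under
  \<open>u = F x + G r\<close>.\<close>

fun tracks_constants :: "time_domain \<Rightarrow> real^'n^'n \<Rightarrow> real^'m^'n \<Rightarrow> real^'n^'p \<Rightarrow> real^'m^'p \<Rightarrow>
    real^'n^'m \<Rightarrow> real^'p^'m \<Rightarrow> bool" where
  "tracks_constants Continuous A B C D F G \<longleftrightarrow> (\<forall>r. \<forall>x :: real \<Rightarrow> real^'n.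
     (\<forall>t\<ge>0. (x has_vector_derivative A *v x t + B *v (F *v x t + G *v r)) (at t within {0..})) \<longrightarrow>
     ((\<lambda>t. C *v x t + D *v (F *v x t + G *v r)) \<longlongrightarrow> r) at_top)"
| "tracks_constants Discrete A B C D F G \<longleftrightarrow> (\<forall>r. \<forall>x :: nat \<Rightarrow> real^'n.
     (\<forall>t. x (Suc t) = A *v x t + B *v (F *v x t + G *v r)) \<longrightarrow>
     ((\<lambda>t. C *v x t + D *v (F *v x t + G *v r)) \<longlonglongrightarrow> r))"

text \<open>State-to-output decoupling for \<open>\<D> \<xi> = M \<xi>\<close>, \<open>\<epsilon> = N \<xi>\<close>. In the families \<open>\<nu>\<close>, \<open>\<mu>\<close>, \<open>v\<close> the
  index \<open>None\<close> stands for the modes unobservable from \<open>\<epsilon>\<close> (index \<open>0\<close> in the usual notation),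
  and \<open>Some i\<close> for those observable from the component \<open>\<epsilon>\<^sub>i\<close>; \<open>\<mu> k j\<close>, \<open>1 \<le> j \<le> \<nu> k\<close>, are the
  corresponding (real) eigenvalues, counted with multiplicity.\<close>

definition output_decoupled ::
  "real^'n^'n \<Rightarrow> real^'n^'p \<Rightarrow> ('p option \<Rightarrow> nat) \<Rightarrow> ('p option \<Rightarrow> nat \<Rightarrow> real) \<Rightarrow> bool" where
  "output_decoupled M N \<nu> \<mu> \<longleftrightarrow> (\<exists>v :: 'p option \<Rightarrow> nat \<Rightarrow> real^'n.
     let J = (SIGMA k:UNIV. {1..\<nu> k}); w = (\<lambda>(k, j). v k j) in
       inj_on w J \<and> independent (w ` J) \<and> span (w ` J) = UNIV \<and>
       (\<forall>(k, j)\<in>J. M *v v k j = \<mu> k j *s v k j) \<and>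
       (\<forall>j\<in>{1..\<nu> None}. N *v v None j = 0) \<and>
       (\<forall>i. \<forall>j\<in>{1..\<nu> (Some i)}. \<exists>\<delta>. \<delta> \<noteq> 0 \<and> N *v v (Some i) j = \<delta> *s axis i 1))"

definition problem_2B_solvable ::
  "time_domain \<Rightarrow> real^'n^'n \<Rightarrow> real^'m^'n \<Rightarrow> real^'n^'p \<Rightarrow> real^'m^'p \<Rightarrow>
    ('p \<Rightarrow> nat) \<Rightarrow> ('p \<Rightarrow> nat \<Rightarrow> real) \<Rightarrow> bool" where
  "problem_2B_solvable td A B C D \<nu> l \<longleftrightarrow> (\<exists>(F :: real^'n^'m) (G :: real^'p^'m).
     spectrum (A + B ** F) \<subseteq> stable_region td \<and>
     closed_loop_gain td A B C D F ** G = mat 1 \<and>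
     tracks_constants td A B C D F G \<and>
     (\<exists>\<mu>\<^sub>0. output_decoupled (A + B ** F) (C + D ** F)
        (case_option (CARD('n) - (\<Sum>i\<in>UNIV. \<nu> i)) \<nu>) (case_option \<mu>\<^sub>0 l)))"

end

theory Submission
  imports Defs
begin

text \<open>Let \<open>S\<close> be the span of the directions \<open>v\<close> with \<open>(A - \<lambda>) v + B w = 0\<close>, \<open>C v + D w = 0\<close> for some
  \<open>w\<close> and some stable real \<open>\<lambda>\<close>. Such directions can be assigned as closed-loop eigenvectors, and so
  can the elements of \<open>R_hat\<close>. Once \<open>V_star_g = S\<close> is known, solvability amounts to the existence
  of an independent transversal of the sets \<open>R_hat i (l i j)\<close> together with \<open>\<nu>\<^sub>0\<close> copies of the
  generating set of \<open>S\<close>, and the dimension inequalities are exactly the condition in Rado's theorem.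

  For \<open>V_star_g \<subseteq> S\<close>, let \<open>q\<close> be orthogonal to \<open>S\<close>. Then \<open>[q 0]\<close> lies in the row space of the pencil
  \<open>P(\<lambda>)\<close> for infinitely many \<open>\<lambda>\<close>, so by Cramer's rule \<open>a P = d [q 0]\<close> with polynomial \<open>a\<close> and \<open>d\<close>,
  without common zeros. A stable zero \<open>z\<close> of \<open>d\<close> would be an invariant zero, hence real, and since
  \<open>[q 0] = c P(z)\<close> the row \<open>(a - d c) P\<close> would vanish to second order at \<open>z\<close>, contradicting
  semisimplicity. Hence \<open>d\<close> has no stable zero. On a stabilizability output-nulling subspace with
  closed loop \<open>M\<close> the identity \<open>a P = d [q 0]\<close> gives \<open>q \<bullet> d(M) x = 0\<close>, and \<open>d(M)\<close> is invertible there.\<close>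

subsection \<open>Row rank and block matrices\<close>

lemma sum_UNIV_sum_type:
  "(\<Sum>s\<in>(UNIV :: ('a::finite + 'b::finite) set). f s) = (\<Sum>i\<in>UNIV. f (Inl i)) + (\<Sum>j\<in>UNIV. f (Inr j))"
  by (simp add: UNIV_Plus_UNIV [symmetric] sum.Plus del: UNIV_Plus_UNIV)

lemma linear_vector_matrix_mult:
  fixes Q :: "'a::field^'c^'r"
  shows "Vector_Spaces.linear (*s) (*s) (\<lambda>c. c v* Q)"
  by unfold_locales
    (simp_all add: vector_matrix_mult_def vec_eq_iff algebra_simps sum.distrib sum_distrib_left)

lemma vector_matrix_mult_rows: "c v* Q = (\<Sum>i\<in>UNIV. c $ i *s row i Q)"
  for Q :: "'a::comm_semiring_1^'c^'r"
  by (simp add: vector_matrix_mult_def vec_eq_iff row_def mult.commute)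

lemma row_vector_matrix_mult_axis: "axis i 1 v* Q = row i Q" for Q :: "'a::comm_semiring_1^'c^'r"
  by (simp add: vector_matrix_mult_rows axis_def if_distrib [of "\<lambda>x. x *s _"] sum.delta cong: if_cong)

text \<open>Extend a basis of the left kernel to a basis of the whole space: the added vectors are
  mapped injectively and their images span the rows. The field is arbitrary because real and complex
  matrices both occur below.\<close>

lemma row_rank_nullity:
  fixes Q :: "'a::field^'c^'r"
  shows "rank Q + vec.dim {c. c v* Q = 0} = CARD('r)"
proof -
  let ?L = "{c. c v* Q = 0}" and ?f = "\<lambda>c. c v* Q"
  interpret f: Vector_Spaces.linear "(*s)" "(*s)" ?f
    by (rule linear_vector_matrix_mult)
  obtain B1 where B1: "B1 \<subseteq> ?L" "vec.independent B1" "?L \<subseteq> vec.span B1" "card B1 = vec.dim ?L"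
    using vec.basis_exists by blast
  obtain B where "B1 \<subseteq> B" "B \<subseteq> UNIV" "vec.independent B" "UNIV \<subseteq> vec.span B"
    by (rule vec.maximal_independent_subset_extend[OF subset_UNIV B1(2)])
  then have B: "B1 \<subseteq> B" "vec.independent B" "UNIV \<subseteq> vec.span B" by auto
  have finB: "finite B" by (rule vec.finiteI_independent[OF B(2)])
  have cardB: "card B = CARD('r)"
  proof -
    have "vec.span B = UNIV" using B(3) by auto
    then show ?thesis
      using vec.dim_eq_card_independent[OF B(2)] vec.dim_span[of B] vec_dim_card by metis
  qed
  \<comment> \<open>A kernel vector in this span has representations supported on \<open>B1\<close>
    and on \<open>B - B1\<close>, so all its coefficients vanish.\<close>
  have inj: "inj_on ?f (vec.span (B - B1))"
  proof (subst f.inj_on_iff_eq_0)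
    show "vec.subspace (vec.span (B - B1))" by simp
    show "\<forall>x\<in>vec.span (B - B1). x v* Q = 0 \<longrightarrow> x = 0"
    proof safe
      fix x assume x: "x \<in> vec.span (B - B1)" "x v* Q = 0"
      then have "x \<in> vec.span B1" using B1(3) by auto
      then have "vec.representation B x = vec.representation B1 x"
        by (rule vec.representation_extend[OF B(2) _ B(1)])
      moreover have "vec.representation B x = vec.representation (B - B1) x"
        by (rule vec.representation_extend[OF B(2) x(1) Diff_subset])
      ultimately have "vec.representation B x b = 0" for b
        by (metis DiffD2 vec.representation_ne_zero)
      moreover have "x \<in> vec.span B" using B(3) by blast
      ultimately show "x = 0"
        using vec.sum_nonzero_representation_eq[OF B(2)] by (metis (no_types, lifting) sum.not_neutral_contains_not_neutral vec.scale_eq_0_iff)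
    qed
  qed
  have "rank Q = vec.dim (?f ` (B - B1))"
  proof -
    have "vec.span (rows Q) = vec.span (?f ` (B - B1))"
    proof
      show "vec.span (rows Q) \<subseteq> vec.span (?f ` (B - B1))"
      proof (rule vec.span_minimal)
        have "row i Q \<in> vec.span (?f ` (B - B1))" for i
        proof -
          have "row i Q \<in> ?f ` vec.span B" using B(3)
            by (metis row_vector_matrix_mult_axis UNIV_I image_eqI subsetD)
          also have "\<dots> = vec.span (?f ` B)" by (rule f.span_image [symmetric])
          also have "\<dots> \<subseteq> vec.span (?f ` (B - B1))"
          proof (rule vec.span_minimal)
            show "?f ` B \<subseteq> vec.span (?f ` (B - B1))"
            proof
              fix y assume "y \<in> ?f ` B"
              then obtain b where "b \<in> B" "y = ?f b" by blast
              moreover have "b v* Q = 0" if "b \<in> B1" using that B1(1) by blast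
              ultimately show "y \<in> vec.span (?f ` (B - B1))"
                by (cases "b \<in> B1") (auto intro: vec.span_base simp: vec.span_zero)
            qed
          qed simp
          finally show ?thesis .
        qed
        then show "rows Q \<subseteq> vec.span (?f ` (B - B1))" by (auto simp: rows_def)
      qed simp
      show "vec.span (?f ` (B - B1)) \<subseteq> vec.span (rows Q)"
      proof (rule vec.span_minimal)
        show "?f ` (B - B1) \<subseteq> vec.span (rows Q)"
          by (auto simp: vector_matrix_mult_rows intro!: vec.span_sum vec.span_scale)
            (auto simp: rows_def intro: vec.span_base)
      qed simp
    qed
    then show ?thesis by (metis row_rank_def_gen vec.dim_span)
  qed
  also have "\<dots> = vec.dim (B - B1)"
    by (rule vec.dim_image_eq[OF linear_vector_matrix_mult inj])
  also have "\<dots> = card (B - B1)"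
    by (metis B(2) Diff_subset vec.independent_mono vec.dim_eq_card_independent)
  also have "\<dots> = CARD('r) - vec.dim ?L"
    using B(1) B1(4) cardB finB by (metis card_Diff_subset finite_subset)
  finally show ?thesis
    using dim_subset_UNIV_cart_gen[of ?L] by simp
qed

lemma full_row_rank_iff:
  fixes Q :: "'a::field^'c^'r"
  shows "rank Q = CARD('r) \<longleftrightarrow> (\<forall>c. c v* Q = 0 \<longrightarrow> c = 0)"
proof -
  have "rank Q = CARD('r) \<longleftrightarrow> vec.dim {c. c v* Q = 0} = 0"
    using row_rank_nullity[of Q] by linarith
  also have "\<dots> \<longleftrightarrow> (\<forall>c. c v* Q = 0 \<longrightarrow> c = 0)"
    by (auto simp: vec.dim_eq_0)
  finally show ?thesis .
qed

lemma rank_le_rows: "rank Q \<le> CARD('r)" for Q :: "'a::field^'c^'r"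
  using row_rank_nullity[of Q] by linarith

lemma full_row_rank_right_invertible:
  fixes Q :: "'a::field^'c^'r"
  assumes "rank Q = CARD('r)"
  shows "\<exists>R. Q ** R = mat 1"
proof -
  have "\<forall>c. (\<Sum>i\<in>UNIV. c i *s row i Q) = 0 \<longrightarrow> (\<forall>i. c i = 0)"
  proof (intro allI impI)
    fix c i assume "(\<Sum>i\<in>UNIV. c i *s row i Q) = 0"
    then have "(\<chi> i. c i) v* Q = 0" by (simp add: vector_matrix_mult_rows)
    then have "(\<chi> i. c i) = 0" using assms full_row_rank_iff by blast
    then show "c i = 0" by (simp add: vec_eq_iff)
  qed
  then show ?thesis by (simp add: matrix_right_invertible_independent_rows)
qed

text \<open>The columns span, so a basis can be picked among them. It has as many members as there
  are rows and is enumerated by the row type, so that \<open>det\<close> applies.\<close>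

lemma full_row_rank_nonzero_minor:
  fixes Q :: "'a::field^'c^'r"
  assumes "rank Q = CARD('r)"
  obtains \<gamma> :: "'r \<Rightarrow> 'c" where "inj \<gamma>" "det (\<chi> i j. Q $ i $ \<gamma> j) \<noteq> 0"
proof -
  have span: "vec.span (columns Q) = UNIV"
    using full_row_rank_right_invertible[OF assms] by (simp add: matrix_right_invertible_span_columns)
  obtain B where B: "B \<subseteq> columns Q" "vec.independent B" "columns Q \<subseteq> vec.span B"
    "card B = vec.dim (columns Q)"
    using vec.basis_exists by blast
  have spanB: "vec.span B = UNIV" using B(3) span
    by (metis top.extremum_uniqueI vec.span_mono vec.span_span)
  have "card B = CARD('r)"
    using B(4) span by (metis vec.dim_span vec_dim_card)
  moreover have "finite B" by (rule vec.finiteI_independent[OF B(2)])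
  ultimately obtain f :: "'r \<Rightarrow> _" where f: "bij_betw f UNIV B"
    by (metis finite_same_card_bij finite_class.finite_UNIV)
  have "\<exists>k. f j = column k Q" for j
    using f B(1) by (fastforce simp: bij_betw_def columns_def)
  then obtain \<gamma> where \<gamma>: "\<And>j. f j = column (\<gamma> j) Q" by metis
  have "inj \<gamma>"
    using f by (metis \<gamma> bij_betw_imp_inj_on injI inj_def)
  moreover have "det (\<chi> i j. Q $ i $ \<gamma> j) \<noteq> 0"
  proof -
    let ?M = "\<chi> i j. Q $ i $ \<gamma> j"
    have "column j ?M = f j" for j by (simp add: \<gamma> column_def)
    then have "columns ?M = B" using f by (auto simp: columns_def bij_betw_def)
    then have "\<exists>R. ?M ** R = mat 1" using spanB by (simp add: matrix_right_invertible_span_columns)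
    then show ?thesis
      by (metis invertible_det_nz invertible_right_inverse)
  qed
  ultimately show thesis using that by blast
qed

section \<open>Block form of the pencil and passage between real and complex data\<close>

definition join_vec :: "'a^'n \<Rightarrow> 'a^'m \<Rightarrow> 'a^('n + 'm)" where
  "join_vec v w = (\<chi> s. case s of Inl i \<Rightarrow> v $ i | Inr k \<Rightarrow> w $ k)"

definition block_matrix ::
  "'a^'n^'n \<Rightarrow> 'a^'m^'n \<Rightarrow> 'a^'n^'p \<Rightarrow> 'a^'m^'p \<Rightarrow> 'a^('n + 'm)^('n + 'p)" where
  "block_matrix A B C D = (\<chi> r c.
     case r of
       Inl i \<Rightarrow> (case c of Inl j \<Rightarrow> A $ i $ j | Inr k \<Rightarrow> B $ i $ k)
     | Inr l \<Rightarrow> (case c of Inl j \<Rightarrow> C $ l $ j | Inr k \<Rightarrow> D $ l $ k))"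

definition cvec :: "real^'n \<Rightarrow> complex^'n" where "cvec v = (\<chi> i. complex_of_real (v $ i))"

definition cmat :: "real^'n^'m \<Rightarrow> complex^'n^'m" where "cmat M = (\<chi> i j. complex_of_real (M $ i $ j))"

lemma join_vec_cases: obtains v w where "x = join_vec v w"
proof -
  have "x = join_vec (\<chi> i. x $ Inl i) (\<chi> j. x $ Inr j)"
    by (auto simp: join_vec_def vec_eq_iff split: sum.splits)
  then show thesis using that by blast
qed

lemma join_vec_eq_iff [simp]: "join_vec v w = join_vec v' w' \<longleftrightarrow> v = v' \<and> w = w'"
  by (auto simp: join_vec_def vec_eq_iff split: sum.splits)

lemma join_vec_0 [simp]: "join_vec 0 0 = 0"
  by (auto simp: join_vec_def vec_eq_iff split: sum.splits)

lemma join_vec_eq_0_iff [simp]: "join_vec v w = 0 \<longleftrightarrow> v = 0 \<and> w = 0"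
  by (metis join_vec_0 join_vec_eq_iff)

lemma block_matrix_mult_join_vec:
  "block_matrix A B C D *v join_vec v w = join_vec (A *v v + B *v w) (C *v v + D *v w)"
  for A :: "'a::comm_semiring_1^'n^'n"
  by (auto simp: vec_eq_iff matrix_vector_mult_def block_matrix_def join_vec_def sum_UNIV_sum_type
      split: sum.splits)

lemma eval_pmat_system_pencil:
  "eval_pmat (system_pencil A B C D) z = block_matrix (cmat A - mat z) (cmat B) (cmat C) (cmat D)"
  by (auto simp: vec_eq_iff eval_pmat_def system_pencil_def block_matrix_def cmat_def mat_def
      split: sum.splits)

lemma eval_pmat_system_pencil_of_real:
  "eval_pmat (system_pencil A B C D) (of_real x) = cmat (block_matrix (A - mat x) B C D)"
  by (auto simp: vec_eq_iff eval_pmat_system_pencil block_matrix_def cmat_def mat_def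
      split: sum.splits)

lemma cvec_mult_cmat: "cvec c v* cmat Q = cvec (c v* Q)"
  by (simp add: cvec_def cmat_def vector_matrix_mult_def vec_eq_iff)

lemma cmat_mult_cvec: "cmat Q *v cvec c = cvec (Q *v c)"
  by (simp add: cvec_def cmat_def matrix_vector_mult_def vec_eq_iff)

lemma cvec_eq_0_iff [simp]: "cvec c = 0 \<longleftrightarrow> c = 0"
  by (simp add: cvec_def vec_eq_iff)

text \<open>A real vector in the left kernel stays there after complexification. This serves the dc
  point, where the rank of the complex pencil is known but real solutions are needed.\<close>

lemma full_row_rank_of_cmat:
  fixes Q :: "real^'c^'r"
  assumes "rank (cmat Q) = CARD('r)"
  shows "rank Q = CARD('r)"
  using assms unfolding full_row_rank_iff
  by (metis cvec_mult_cmat cvec_eq_0_iff)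

lemma join_vec_cvec: "join_vec (cvec v) (cvec w) = cvec (join_vec v w)"
  by (auto simp: join_vec_def cvec_def vec_eq_iff split: sum.splits)

text \<open>The row space is the orthogonal complement of the kernel: the component \<open>t\<close>
  of \<open>q\<close> orthogonal to the rows lies in the kernel, so
  \<open>t \<bullet> t = q \<bullet> t = 0\<close>.\<close>

lemma annihilator_in_row_space:
  fixes Q :: "real^'c^'r"
  assumes "\<And>x. Q *v x = 0 \<Longrightarrow> q \<bullet> x = 0"
  obtains c where "q = c v* Q"
proof -
  obtain s t where st: "s \<in> span (rows Q)" "\<And>w. w \<in> span (rows Q) \<Longrightarrow> orthogonal t w" "q = s + t"
    using orthogonal_subspace_decomp_exists[of "rows Q" q] by metis
  have "row i Q \<bullet> t = 0" for i
    using st(2)[of "row i Q"] by (auto simp: rows_def orthogonal_def inner_commute intro: span_base)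
  then have "Q *v t = 0"
    by (simp add: vec_eq_iff matrix_vector_mult_def row_def inner_vec_def)
  then have "q \<bullet> t = 0" by (rule assms)
  moreover have "s \<bullet> t = 0" using st(2)[OF st(1)] by (simp add: orthogonal_def inner_commute)
  ultimately have "t = 0" using st(3) by (simp add: inner_add_left)
  then have "q \<in> span (range (\<lambda>i. row i Q))"
    using st by (simp add: rows_def full_SetCompr_eq)
  also have "\<dots> \<subseteq> range (\<lambda>c. c v* Q)"
  proof (rule span_minimal)
    show "range (\<lambda>i. row i Q) \<subseteq> range (\<lambda>c. c v* Q)"
      by (metis row_vector_matrix_mult_axis image_subsetI rangeI)
    have "subspace (range (\<lambda>c. c v* Q))"
      using linear_subspace_image[of "\<lambda>c. c v* Q" UNIV] linear_vector_matrix_mult[of Q]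
      by (simp add: linear_iff vector_matrix_mult_def vec_eq_iff algebra_simps sum.distrib sum_distrib_left)
    then show "subspace (range (\<lambda>c. c v* Q))" .
  qed
  finally show thesis using that by blast
qed

subsection \<open>Minors and semisimple zeros of polynomial matrices\<close>

text \<open>Keeps the enumerations visible, which the expansion along a row and the comparison with
  \<open>det\<close> need and the set \<open>minors\<close> hides.\<close>

definition minor :: "nat \<Rightarrow> 'a::comm_ring_1^'c^'r \<Rightarrow> (nat \<Rightarrow> 'r) \<Rightarrow> (nat \<Rightarrow> 'c) \<Rightarrow> 'a" where
  "minor k M \<rho> \<gamma> = (\<Sum>\<pi> | \<pi> permutes {..<k}. of_int (sign \<pi>) * (\<Prod>i<k. M $ \<rho> i $ \<gamma> (\<pi> i)))"

lemma minors_eq: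
  "minors k M = {minor k M \<rho> \<gamma> | \<rho> \<gamma>. inj_on \<rho> {..<k} \<and> inj_on \<gamma> {..<k}}"
  by (simp add: minors_def minor_def)

text \<open>Laplace expansion along the last row \<open>\<rho> k\<close>: every permutation of
  \<open>k + 1\<close> indices is uniquely a transposition of \<open>k\<close> and some
  \<open>b\<close> after a permutation fixing \<open>k\<close>.\<close>

lemma minor_Suc:
  fixes M :: "'a::comm_ring_1^'c^'r"
  shows "minor (Suc k) M \<rho> \<gamma> =
    (\<Sum>b<Suc k. of_int (sign (Transposition.transpose k b)) * M $ \<rho> k $ \<gamma> b * minor k M \<rho> (\<gamma> \<circ> Transposition.transpose k b))"
proof -
  have "minor (Suc k) M \<rho> \<gamma> = (\<Sum>b\<in>insert k {..<k}. \<Sum>q | q permutes {..<k}.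
     of_int (sign (Transposition.transpose k b \<circ> q)) * (\<Prod>i<Suc k. M $ \<rho> i $ \<gamma> ((Transposition.transpose k b \<circ> q) i)))"
    unfolding minor_def lessThan_Suc by (rule sum_over_permutations_insert) auto
  also have "\<dots> = (\<Sum>b<Suc k. of_int (sign (Transposition.transpose k b)) * M $ \<rho> k $ \<gamma> b * minor k M \<rho> (\<gamma> \<circ> Transposition.transpose k b))"
    unfolding lessThan_Suc [symmetric]
  proof (rule sum.cong [OF refl])
    fix b
    show "(\<Sum>q | q permutes {..<k}.
       of_int (sign (Transposition.transpose k b \<circ> q)) * (\<Prod>i<Suc k. M $ \<rho> i $ \<gamma> ((Transposition.transpose k b \<circ> q) i)) :: 'a) =
      of_int (sign (Transposition.transpose k b)) * M $ \<rho> k $ \<gamma> b * minor k M \<rho> (\<gamma> \<circ> Transposition.transpose k b)"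
      unfolding minor_def sum_distrib_left
    proof (rule sum.cong [OF refl])
      fix q assume "q \<in> {q. q permutes {..<k}}"
      then have q: "q permutes {..<k}" by simp
      then have "permutation q" by (rule permutes_imp_permutation [rotated]) simp
      then have "sign (Transposition.transpose k b \<circ> q) = sign (Transposition.transpose k b) * sign q"
        by (simp add: sign_compose permutation_swap_id)
      moreover have "q k = k" using q by (simp add: permutes_not_in)
      ultimately show "of_int (sign (Transposition.transpose k b \<circ> q)) *
          (\<Prod>i<Suc k. M $ \<rho> i $ \<gamma> ((Transposition.transpose k b \<circ> q) i)) =
        of_int (sign (Transposition.transpose k b)) * M $ \<rho> k $ \<gamma> b *
          (of_int (sign q) * (\<Prod>i<k. M $ \<rho> i $ (\<gamma> \<circ> Transposition.transpose k b) (q i)))"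
        by (simp add: algebra_simps)
    qed
  qed
  finally show ?thesis .
qed

text \<open>Laplace expansion writes each minor of order \<open>Suc k\<close> as a combination of
  minors of order \<open>k\<close>. This makes the divisions in \<open>invariant_poly\<close>
  exact.\<close>

lemma determinantal_divisor_Suc_dvd:
  "determinantal_divisor P k dvd determinantal_divisor P (Suc k)"
  unfolding determinantal_divisor_def
proof (rule Gcd_greatest)
  fix m assume "m \<in> minors (Suc k) P"
  then obtain \<rho> \<gamma> where m: "m = minor (Suc k) P \<rho> \<gamma>" and inj: "inj_on \<rho> {..<Suc k}" "inj_on \<gamma> {..<Suc k}"
    by (auto simp: minors_eq)
  show "Gcd (minors k P) dvd m"
    unfolding m minor_Suc
  proof (intro dvd_sum dvd_mult Gcd_dvd)
    fix b assume "b \<in> {..<Suc k}"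
    then have "Transposition.transpose k b ` {..<k} \<subseteq> {..<Suc k}"
      by (auto simp: Transposition.transpose_def)
    then have "inj_on (\<gamma> \<circ> Transposition.transpose k b) {..<k}"
      by (intro comp_inj_on inj_on_subset [OF inj(2)] inj_on_inverseI [where g = "Transposition.transpose k b"]) auto
    moreover have "inj_on \<rho> {..<k}" by (rule inj_on_subset [OF inj(1)]) auto
    ultimately show "minor k P \<rho> (\<gamma> \<circ> Transposition.transpose k b) \<in> minors k P"
      by (auto simp: minors_eq)
  qed
qed

lemma determinantal_divisor_0: "determinantal_divisor P 0 = 1"
  by (simp add: determinantal_divisor_def minors_eq minor_def)

text \<open>The quotients of consecutive divisors telescope. With \<open>n\<close> the normal rank
  this turns \<open>zero_alg_mult\<close> into the order of \<open>z\<close> in a single gcd of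
  minors.\<close>

lemma sum_order_invariant_polys:
  assumes "determinantal_divisor P n \<noteq> 0"
  shows "(\<Sum>k = 1..n. order z (invariant_poly P k)) = order z (determinantal_divisor P n)"
  using assms
proof (induction n)
  case 0
  then show ?case by (simp add: determinantal_divisor_0)
next
  case (Suc n)
  obtain q where q: "determinantal_divisor P (Suc n) = determinantal_divisor P n * q"
    using determinantal_divisor_Suc_dvd [of P n] by blast
  with Suc.prems have nz: "determinantal_divisor P n \<noteq> 0" "q \<noteq> 0" by auto
  then have "invariant_poly P (Suc n) = q"
    by (simp add: invariant_poly_def q)
  moreover have "order z (determinantal_divisor P (Suc n)) = order z (determinantal_divisor P n) + order z q"
    using nz by (simp add: q order_mult)
  ultimately show ?case using Suc.IH nz by simp
qed

text \<open>Transport along \<open>\<rho>\<close> turns permutations of \<open>{..<n}\<close> into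
  permutations of the row type and preserves signs.\<close>

lemma minor_eq_det:
  fixes M :: "'a::comm_ring_1^'c^'r"
  assumes \<rho>: "bij_betw \<rho> {..<n} UNIV"
  shows "minor n M \<rho> \<gamma> = det (\<chi> i j. M $ i $ \<gamma> (inv_into {..<n} \<rho> j))"
proof -
  let ?i = "inv_into {..<n} \<rho>"
  have inj: "inj_on \<rho> {..<n}" using \<rho> by (rule bij_betw_imp_inj_on)
  have inv: "bij_betw ?i UNIV {..<n}" using \<rho> by (rule bij_betw_inv_into)
  have inv1: "?i (\<rho> x) = x" if "x \<in> {..<n}" for x
    using inj that by (rule inv_into_f_f)
  have inv2: "\<rho> (?i x) = x" for x
    using \<rho> by (simp add: bij_betw_inv_into_right)
  have "minor n M \<rho> \<gamma> = (\<Sum>p | p permutes (UNIV :: 'r set).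
    of_int (sign p) * (\<Prod>i\<in>UNIV. M $ i $ \<gamma> (?i (p i))))"
    unfolding minor_def
  proof (rule sum.reindex_bij_witness [where i = "map_permutation UNIV ?i" and j = "map_permutation {..<n} \<rho>"])
    fix \<pi> assume "\<pi> \<in> {\<pi>. \<pi> permutes {..<n}}"
    then have \<pi>: "\<pi> permutes {..<n}" by simp
    show "map_permutation UNIV ?i (map_permutation {..<n} \<rho> \<pi>) = \<pi>"
      by (rule map_permutation_compose_inv [OF \<rho> \<pi> inv1])
    show "map_permutation {..<n} \<rho> \<pi> \<in> {p. p permutes UNIV}"
      using map_permutation_permutes [OF \<rho> \<pi>] by simp
    have "(\<Prod>i\<in>UNIV. M $ i $ \<gamma> (?i (map_permutation {..<n} \<rho> \<pi> i))) =
      (\<Prod>i<n. M $ \<rho> i $ \<gamma> (?i (map_permutation {..<n} \<rho> \<pi> (\<rho> i))))"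
      by (rule prod.reindex_bij_betw [OF \<rho>, symmetric])
    also have "\<dots> = (\<Prod>i<n. M $ \<rho> i $ \<gamma> (\<pi> i))"
    proof (rule prod.cong [OF refl])
      fix i assume "i \<in> {..<n}"
      then show "M $ \<rho> i $ \<gamma> (?i (map_permutation {..<n} \<rho> \<pi> (\<rho> i))) = M $ \<rho> i $ \<gamma> (\<pi> i)"
        using permutes_in_image [OF \<pi>] by (simp add: map_permutation_apply [OF inj] inv1)
    qed
    finally show "of_int (sign (map_permutation {..<n} \<rho> \<pi>)) *
         (\<Prod>i\<in>UNIV. M $ i $ \<gamma> (?i (map_permutation {..<n} \<rho> \<pi> i))) =
         of_int (sign \<pi>) * (\<Prod>i<n. M $ \<rho> i $ \<gamma> (\<pi> i))"
      by (simp add: sign_map_permutation [OF inj \<pi>])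
  next
    fix p assume "p \<in> {p. p permutes (UNIV :: 'r set)}"
    then have p: "p permutes UNIV" by simp
    show "map_permutation {..<n} \<rho> (map_permutation UNIV ?i p) = p"
      by (rule map_permutation_compose_inv [OF inv p inv2])
    show "map_permutation UNIV ?i p \<in> {\<pi>. \<pi> permutes {..<n}}"
      using map_permutation_permutes [OF inv p] by simp
  qed
  then show ?thesis by (simp add: det_def)
qed

section \<open>Order of vanishing of maximal minors at a zero\<close>

lemma poly_det: "poly (det M) z = det (\<chi> i j. poly (M $ i $ j) z)"
  for M :: "'a::comm_ring_1 poly^'n^'n"
  by (simp add: det_def poly_sum poly_prod)

lemma poly_vector_matrix_mult:
  "poly ((r v* P) $ j) z = ((\<chi> i. poly (r $ i) z) v* eval_pmat P z) $ j"
  by (simp add: vector_matrix_mult_def eval_pmat_def poly_sum)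

text \<open>Multiplicity at \<open>z\<close> is additive, and \<open>p\<close> contributes
  none.\<close>

lemma linear_power_dvd_cancel:
  fixes p q :: "'a::idom poly"
  assumes "[:-z, 1:] ^ n dvd p * q" and "poly p z \<noteq> 0"
  shows "[:-z, 1:] ^ n dvd q"
proof (cases "q = 0")
  case False
  have "p \<noteq> 0" "order z p = 0" using assms(2) by (auto simp: order_0I)
  then have "order z (p * q) = order z q" using False by (simp add: order_mult)
  then show ?thesis using assms(1) \<open>p \<noteq> 0\<close> False by (simp only: order_divides mult_eq_0_iff) simp
qed simp

text \<open>Replacing some rows by a basis of the left kernel of \<open>P(z)\<close> makes each of them divisible by
  \<open>X - z\<close>, and the one that is the combination \<open>r\<close> divisible by its square.\<close>

lemma linear_power_dvd_maximal_minor: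
  fixes P :: "complex poly^'c^'r" and r :: "complex poly^'r" and \<gamma> :: "'r \<Rightarrow> 'c"
  assumes r0: "(\<chi> i. poly (r $ i) z) \<noteq> 0"
    and r2: "\<And>j. [:-z, 1:] ^ 2 dvd (r v* P) $ j"
  shows "[:-z, 1:] ^ Suc (CARD('r) - rank (eval_pmat P z)) dvd det (\<chi> i j. P $ i $ \<gamma> j)"
proof -
  define X where "X = [:-z, 1:]"
  define e0 where "e0 = (\<chi> i. poly (r $ i) z)"
  define L where "L = {c. c v* eval_pmat P z = 0}"
  let ?Q = "\<chi> i j. P $ i $ \<gamma> j"
  have X_dvd: "X dvd p \<longleftrightarrow> poly p z = 0" for p
    by (simp add: X_def poly_eq_0_iff_dvd)
  have "X dvd (r v* P) $ j" for j
    using r2 [of j] by (metis X_def dvd_power dvd_trans zero_less_numeral)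
  \<comment> \<open>Simple vanishing already puts the value \<open>e0\<close> of \<open>r\<close> at
    \<open>z\<close> into the left kernel; the basis \<open>B1\<close> of the kernel is then chosen
    to contain it.\<close>
  then have "e0 \<in> L"
    unfolding X_dvd by (simp add: L_def e0_def vec_eq_iff poly_vector_matrix_mult)
  then have e0L: "{e0} \<subseteq> L" by simp
  have e0ind: "vec.independent {e0}" using r0 by (simp add: e0_def)
  obtain B1 where B1: "{e0} \<subseteq> B1" "B1 \<subseteq> L" "vec.independent B1" "L \<subseteq> vec.span B1"
    by (rule vec.maximal_independent_subset_extend [OF e0L e0ind])
  have dimL: "card B1 = CARD('r) - rank (eval_pmat P z)"
  proof -
    have "card B1 = vec.dim L"
      using B1 by (metis vec.basis_card_eq_dim)
    then show ?thesis using row_rank_nullity [of "eval_pmat P z"] by (simp add: L_def)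
  qed
  obtain B where "B1 \<subseteq> B" "B \<subseteq> UNIV" "vec.independent B" "UNIV \<subseteq> vec.span B"
    by (rule vec.maximal_independent_subset_extend [OF subset_UNIV B1(3)])
  then have B: "B1 \<subseteq> B" "vec.independent B" "vec.span B = UNIV" by auto
  have "card B = CARD('r)"
    using vec.dim_eq_card_independent [OF B(2)] B(3) vec.dim_span [of B] vec_dim_card by metis
  moreover have "finite B" by (rule vec.finiteI_independent [OF B(2)])
  ultimately obtain f :: "'r \<Rightarrow> complex^'r" where f: "bij_betw f UNIV B"
    by (metis finite_same_card_bij finite_class.finite_UNIV)
  have inj_f: "inj f" and range_f: "range f = B" using f by (auto simp: bij_betw_def)
  \<comment> \<open>Row multipliers: constant basis vectors, except that \<open>e0\<close> is
    replaced by the polynomial row \<open>r\<close> having this value. At \<open>z\<close> the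
    matrix \<open>T\<close> is thus the invertible basis matrix.\<close>
  define T where "T = (\<lambda>i. if f i = e0 then r else (\<chi> k. [:f i $ k:]))"
  have T_z: "poly (T i $ k) z = f i $ k" for i k
    by (auto simp: T_def e0_def)
  have "rows (\<chi> i. f i) = B"
    using range_f by (auto simp: rows_def row_def)
  then have "det (\<chi> i. f i) \<noteq> 0"
    using B(3) by (metis invertible_det_nz invertible_left_inverse matrix_left_invertible_span_rows_gen)
  then have det_T: "poly (det (\<chi> i. T i)) z \<noteq> 0"
    by (simp add: poly_det T_z)
  \<comment> \<open>A guaranteed order of vanishing of the \<open>i\<close>-th transformed row: one
    for a kernel vector, one more for \<open>e0\<close>. The total is
    \<open>Suc (card B1)\<close>.\<close>
  define e where "e = (\<lambda>i. (if f i \<in> B1 then 1 else 0) + (if f i = e0 then 1 else 0 :: nat))"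
  have "X ^ e i dvd (T i v* P) $ j" for i j
  proof (cases "f i = e0")
    case True
    then show ?thesis using B1(1) r2 [of j] by (simp add: e_def T_def X_def numeral_2_eq_2)
  next
    case False
    show ?thesis
    proof (cases "f i \<in> B1")
      case True
      then have "f i v* eval_pmat P z = 0" using B1(2) by (auto simp: L_def)
      then have "X dvd (T i v* P) $ j"
        by (simp add: X_dvd poly_vector_matrix_mult T_z)
      then show ?thesis using True False by (simp add: e_def)
    qed (use False in \<open>simp add: e_def\<close>)
  qed
  then obtain u where u: "\<And>i j. (T i v* P) $ j = X ^ e i * u i j"
    unfolding dvd_def by metis
  \<comment> \<open>The powers of \<open>X\<close> are pulled out of the rows of the product; the
    factor \<open>det T\<close>, nonzero at \<open>z\<close>, is cancelled afterwards.\<close>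
  have "(\<chi> i. T i) ** ?Q = (\<chi> i. X ^ e i *s (\<chi> j. u i (\<gamma> j)))"
    by (simp add: vec_eq_iff u [symmetric]) (simp add: matrix_matrix_mult_def vector_matrix_mult_def mult.commute)
  then have "det (\<chi> i. T i) * det ?Q = (\<Prod>i\<in>UNIV. X ^ e i) * det (\<chi> i j. u i (\<gamma> j))"
    by (simp only: det_mul [symmetric] det_rows_mul)
  also have "(\<Prod>i\<in>UNIV. X ^ e i) = X ^ Suc (card B1)"
  proof -
    have "(\<Sum>i\<in>UNIV. e i) = (\<Sum>b\<in>B. (if b \<in> B1 then 1 else 0) + (if b = e0 then 1 else 0 :: nat))"
      unfolding e_def by (rule sum.reindex_bij_betw [OF f])
    also have "\<dots> = card (B \<inter> B1) + card (B \<inter> {e0})"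
      using \<open>finite B\<close> by (simp add: sum.distrib sum.If_cases Collect_conj_eq)
    also have "\<dots> = Suc (card B1)"
    proof -
      have "B \<inter> B1 = B1" "B \<inter> {e0} = {e0}" using B(1) B1(1) by auto
      then show ?thesis by simp
    qed
    finally show ?thesis by (simp add: power_sum [symmetric])
  qed
  finally have "X ^ Suc (card B1) dvd det (\<chi> i. T i) * det ?Q" by simp
  then have "X ^ Suc (card B1) dvd det ?Q"
    using det_T unfolding X_def by (rule linear_power_dvd_cancel)
  then show ?thesis unfolding X_def dimL .
qed

lemma normal_rank_full:
  fixes P :: "complex poly^'c^'r"
  assumes "rank (eval_pmat P z0) = CARD('r)"
  shows "normal_rank P = CARD('r)"
  unfolding normal_rank_def
proof (rule Max_eqI)
  show "finite (range (\<lambda>z. rank (eval_pmat P z)))"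
    by (rule finite_subset [of _ "{..CARD('r)}"]) (auto simp: rank_le_rows)
  show "CARD('r) \<in> range (\<lambda>z. rank (eval_pmat P z))" using assms by (metis rangeI)
qed (auto simp: rank_le_rows)

text \<open>Otherwise all maximal minors, hence their gcd, would vanish at \<open>z\<close> to an
  order exceeding the rank deficiency, whereas the order of this gcd is the algebraic multiplicity.
  Full rank at \<open>z0\<close> makes the gcd nonzero, so that its order is meaningful.\<close>

lemma semisimple_zero:
  fixes P :: "complex poly^'c^'r" and r :: "complex poly^'r"
  assumes full: "rank (eval_pmat P z0) = CARD('r)"
    and mult: "zero_alg_mult P z = zero_geom_mult P z"
    and r2: "\<And>j. [:-z, 1:] ^ 2 dvd (r v* P) $ j"
  shows "poly (r $ i) z = 0"
proof (rule ccontr)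
  assume "poly (r $ i) z \<noteq> 0"
  then have r0: "(\<chi> i. poly (r $ i) z) \<noteq> 0" by (auto simp: vec_eq_iff)
  note n = normal_rank_full [OF full]
  let ?g = "CARD('r) - rank (eval_pmat P z)"
  have "[:-z, 1:] ^ Suc ?g dvd determinantal_divisor P CARD('r)"
    unfolding determinantal_divisor_def
  proof (rule Gcd_greatest)
    fix m assume "m \<in> minors CARD('r) P"
    then obtain \<rho> \<gamma> where m: "m = minor CARD('r) P \<rho> \<gamma>" and "inj_on \<rho> {..<CARD('r)}"
      by (auto simp: minors_eq)
    then have "bij_betw \<rho> {..<CARD('r)} UNIV"
      by (metis card_image card_lessThan finite_class.finite_UNIV card_subset_eq subset_UNIV bij_betw_def)
    then show "[:-z, 1:] ^ Suc ?g dvd m"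
      using linear_power_dvd_maximal_minor [OF r0 r2, of "\<gamma> \<circ> inv_into {..<CARD('r)} \<rho>"]
      by (simp add: m minor_eq_det)
  qed
  moreover have nz: "determinantal_divisor P CARD('r) \<noteq> 0"
  proof -
    obtain \<gamma> :: "'r \<Rightarrow> 'c" where \<gamma>: "inj \<gamma>" "det (\<chi> i j. eval_pmat P z0 $ i $ \<gamma> j) \<noteq> 0"
      by (rule full_row_rank_nonzero_minor [OF full])
    obtain \<rho> :: "nat \<Rightarrow> 'r" where \<rho>: "bij_betw \<rho> {..<CARD('r)} UNIV"
      by (metis card_lessThan finite_class.finite_UNIV finite_lessThan finite_same_card_bij)
    let ?m = "minor CARD('r) P \<rho> (\<gamma> \<circ> \<rho>)"
    have "?m = det (\<chi> i j. P $ i $ \<gamma> j)"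
      using \<rho> by (simp add: minor_eq_det bij_betw_inv_into_right)
    then have "poly ?m z0 \<noteq> 0" using \<gamma>(2) by (simp add: poly_det eval_pmat_def)
    then have "?m \<noteq> 0" by auto
    moreover have "?m \<in> minors CARD('r) P"
      using \<rho> \<gamma>(1) unfolding minors_eq
      by (auto simp: bij_betw_def intro!: exI comp_inj_on intro: inj_on_subset)
    ultimately show ?thesis unfolding determinantal_divisor_def Gcd_0_iff by blast
  qed
  ultimately have "Suc ?g \<le> order z (determinantal_divisor P CARD('r))"
    by (metis order_divides)
  then have "Suc ?g \<le> zero_alg_mult P z"
    by (simp only: zero_alg_mult_def n sum_order_invariant_polys [OF nz])
  then show False using mult by (simp add: zero_geom_mult_def n)
qed

subsection \<open>Polynomial combinations of the rows\<close>

text \<open>Cramer's rule for one maximal square submatrix, whose determinant \<open>d\<close> is a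
  nonzero polynomial because it does not vanish at \<open>z0\<close>.\<close>

lemma polynomial_row_certificate:
  fixes P :: "complex poly^'c^'r" and q :: "complex^'c"
  assumes inf: "infinite {z. \<exists>c. q = c v* eval_pmat P z}"
    and full: "rank (eval_pmat P z0) = CARD('r)"
  obtains a d where "d \<noteq> 0" "\<And>j. (a v* P) $ j = smult (q $ j) d"
proof -
  obtain \<gamma> :: "'r \<Rightarrow> 'c" where \<gamma>: "inj \<gamma>" "det (\<chi> i j. eval_pmat P z0 $ i $ \<gamma> j) \<noteq> 0"
    by (rule full_row_rank_nonzero_minor [OF full])
  define d where "d = det (\<chi> i j. P $ i $ \<gamma> j)"
  \<comment> \<open>The numerators of Cramer's rule: row \<open>k\<close> of the square submatrix is
    replaced by the selected entries of \<open>q\<close>.\<close>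
  define a where "a = (\<chi> k. det (\<chi> i. if i = k then (\<chi> j. [:q $ \<gamma> j:]) else (\<chi> j. P $ i $ \<gamma> j)))"
  have "poly d z0 \<noteq> 0" using \<gamma>(2) by (simp add: d_def poly_det eval_pmat_def)
  then have "d \<noteq> 0" by auto
  moreover have "(a v* P) $ j = smult (q $ j) d" for j
  proof -
    have "poly ((a v* P) $ j - smult (q $ j) d) z = 0" if z: "\<exists>c. q = c v* eval_pmat P z" for z
    proof -
      obtain c where c: "q = c v* eval_pmat P z" using z by blast
      let ?M = "\<chi> i j. poly (P $ i $ \<gamma> j) z"
      have "poly (a $ k) z = c $ k * poly d z" for k
      proof -
        have "poly (a $ k) z = det (\<chi> i j. poly ((if i = k then (\<chi> j. [:q $ \<gamma> j:]) else (\<chi> j. P $ i $ \<gamma> j)) $ j) z)"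
          by (simp add: a_def poly_det)
        also have "(\<chi> i j. poly ((if i = k then (\<chi> j. [:q $ \<gamma> j:]) else (\<chi> j. P $ i $ \<gamma> j)) $ j) z) =
          (\<chi> i. if i = k then (\<Sum>i\<in>UNIV. c $ i *s row i ?M) else row i ?M)"
          by (simp add: vec_eq_iff row_def c vector_matrix_mult_def eval_pmat_def mult.commute)
        also have "det \<dots> = c $ k * det ?M" by (rule cramer_lemma_transpose)
        also have "det ?M = poly d z" by (simp add: d_def poly_det)
        finally show ?thesis .
      qed
      \<comment> \<open>At such a point the value of \<open>a\<close> is \<open>d(z)\<close> times
        \<open>c\<close>, which gives the identity in every column, also in those that
        \<open>\<gamma>\<close> does not select. Infinitely many such points make it a polynomial
        identity.\<close>
      then have "(\<chi> i. poly (a $ i) z) = poly d z *s c" by (simp add: vec_eq_iff)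
      moreover have "((poly d z *s c) v* eval_pmat P z) $ j = poly d z * q $ j"
        by (simp add: c vector_matrix_mult_def sum_distrib_left mult_ac)
      ultimately show ?thesis by (simp add: poly_vector_matrix_mult)
    qed
    then have "infinite {z. poly ((a v* P) $ j - smult (q $ j) d) z = 0}"
      by (intro infinite_super [OF _ inf]) auto
    then have "(a v* P) $ j - smult (q $ j) d = 0" using poly_roots_finite by blast
    then show ?thesis by simp
  qed
  ultimately show thesis using that by blast
qed

lemma degree_linear_mult: "p \<noteq> 0 \<Longrightarrow> degree ([:-z, 1:] * p) = Suc (degree p)"
  for p :: "'a::idom poly"
  by (subst degree_mult_eq) auto

text \<open>A common zero of \<open>d\<close> and all entries of \<open>a\<close> yields a linear
  factor that cancels from the identity and lowers the degree of \<open>d\<close>.\<close>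

lemma primitive_row_certificate:
  fixes P :: "complex poly^'c^'r" and q :: "complex^'c"
  assumes "d \<noteq> 0" "\<And>j. (a v* P) $ j = smult (q $ j) d"
  shows "\<exists>a d. d \<noteq> 0 \<and> (\<forall>j. (a v* P) $ j = smult (q $ j) d) \<and>
    (\<forall>z. poly d z = 0 \<longrightarrow> (\<exists>i. poly (a $ i) z \<noteq> 0))"
  using assms
proof (induction "degree d" arbitrary: a d rule: less_induct)
  case less
  show ?case
  proof (cases "\<exists>z. poly d z = 0 \<and> (\<forall>i. poly (a $ i) z = 0)")
    case True
    then obtain z where "[:-z, 1:] dvd d" "\<And>i. [:-z, 1:] dvd a $ i"
      by (auto simp: poly_eq_0_iff_dvd)
    then obtain d1 a1 where d1: "d = [:-z, 1:] * d1" and a1: "\<And>i. a $ i = [:-z, 1:] * a1 i"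
      unfolding dvd_def by metis
    have "((\<chi> i. a1 i) v* P) $ j = smult (q $ j) d1" for j
    proof -
      have "[:-z, 1:] * ((\<chi> i. a1 i) v* P) $ j = (a v* P) $ j"
        by (simp only: vector_matrix_mult_def a1 vec_lambda_beta sum_distrib_left mult_ac)
      also have "\<dots> = [:-z, 1:] * smult (q $ j) d1"
        unfolding less.prems(2) d1 by (rule mult_smult_right [symmetric])
      finally show ?thesis by (metis mult_left_cancel pCons_eq_0_iff one_neq_zero)
    qed
    moreover have "d1 \<noteq> 0" using less.prems(1) d1 by auto
    moreover have "degree d1 < degree d" unfolding d1 degree_linear_mult [OF \<open>d1 \<noteq> 0\<close>] by simp
    ultimately show ?thesis using less.hyps [of d1 "\<chi> i. a1 i"] by blast
  qed (use less.prems in blast)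
qed

section \<open>Polynomials in the shift acting on sequences\<close>

text \<open>\<open>seq_act p s\<close> is the value at time \<open>0\<close> of the sequence \<open>p(\<sigma>) s\<close>, where \<open>\<sigma>\<close> is the shift.\<close>

definition seq_act :: "complex poly \<Rightarrow> (nat \<Rightarrow> complex) \<Rightarrow> complex" where
  "seq_act p s = (\<Sum>k\<le>degree p. coeff p k * s k)"

lemma seq_act_eq_sum: "degree p \<le> K \<Longrightarrow> seq_act p s = (\<Sum>k\<le>K. coeff p k * s k)"
  unfolding seq_act_def by (rule sum.mono_neutral_left) (auto simp: coeff_eq_0)

lemma seq_act_0 [simp]: "seq_act 0 s = 0"
  by (simp add: seq_act_def)

lemma seq_act_add: "seq_act (p + q) s = seq_act p s + seq_act q s"
proof -
  let ?K = "max (degree p) (degree q)"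
  show ?thesis
    by (simp add: seq_act_eq_sum [of _ ?K] degree_add_le algebra_simps sum.distrib)
qed

lemma seq_act_smult: "seq_act (smult c p) s = c * seq_act p s"
  by (simp add: seq_act_eq_sum [of _ "degree p"] degree_smult_le sum_distrib_left mult_ac)

lemma seq_act_sum: "seq_act (\<Sum>i\<in>X. f i) s = (\<Sum>i\<in>X. seq_act (f i) s)"
  by (induction X rule: infinite_finite_induct) (auto simp: seq_act_add)

lemma seq_act_pCons: "seq_act (pCons c p) s = c * s 0 + seq_act p (\<lambda>k. s (Suc k))"
proof -
  have "seq_act (pCons c p) s = (\<Sum>k\<le>Suc (degree p). coeff (pCons c p) k * s k)"
    by (rule seq_act_eq_sum) (rule degree_pCons_le)
  also have "\<dots> = c * s 0 + (\<Sum>k\<le>degree p. coeff p k * s (Suc k))"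
    by (simp only: sum.atMost_Suc_shift) simp
  finally show ?thesis by (simp add: seq_act_def)
qed

lemma seq_act_sum_right: "seq_act p (\<lambda>k. \<Sum>i\<in>X. c i * s i k) = (\<Sum>i\<in>X. c i * seq_act p (s i))"
  by (simp add: seq_act_def sum_distrib_left sum.swap [of _ X] mult_ac)

lemma seq_act_diff_right: "seq_act p (\<lambda>k. s k - c * t k) = seq_act p s - c * seq_act p t"
  by (simp add: seq_act_def sum_distrib_left sum_subtractf algebra_simps)

lemma seq_act_linear_mult:
  "seq_act ([:b, c:] * p) s = b * seq_act p s + c * seq_act p (\<lambda>k. s (Suc k))"
  by (simp add: seq_act_add seq_act_smult seq_act_pCons)

section \<open>Complexified invariant subspaces\<close>

definition complexification :: "(real^'n) set \<Rightarrow> (complex^'n) set" where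
  "complexification V = {v. (\<chi> i. Re (v $ i)) \<in> V \<and> (\<chi> i. Im (v $ i)) \<in> V}"

lemma Re_cmat_mult: "(\<chi> i. Re ((cmat M *v v) $ i)) = M *v (\<chi> i. Re (v $ i))"
  by (simp add: vec_eq_iff matrix_vector_mult_def cmat_def)

lemma Im_cmat_mult: "(\<chi> i. Im ((cmat M *v v) $ i)) = M *v (\<chi> i. Im (v $ i))"
  by (simp add: vec_eq_iff matrix_vector_mult_def cmat_def)

lemma cvec_in_complexification: "subspace V \<Longrightarrow> cvec v \<in> complexification V \<longleftrightarrow> v \<in> V"
  by (auto simp: complexification_def cvec_def subspace_0 zero_vec_def [symmetric])

lemma cmat_mult_complexification:
  "(\<lambda>x. M *v x) ` V \<subseteq> V \<Longrightarrow> v \<in> complexification V \<Longrightarrow> cmat M *v v \<in> complexification V"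
  by (auto simp: complexification_def Re_cmat_mult Im_cmat_mult)

lemma cmat_kernel_complexification:
  assumes "V \<subseteq> {x. M *v x = 0}" "v \<in> complexification V"
  shows "cmat M *v v = 0"
proof -
  have "M *v (\<chi> i. Re (v $ i)) = 0" "M *v (\<chi> i. Im (v $ i)) = 0"
    using assms by (auto simp: complexification_def)
  then show ?thesis
    by (simp add: vec_eq_iff complex_eq_iff flip: Re_cmat_mult Im_cmat_mult)
qed

lemma subspace_complexification:
  assumes "subspace V"
  shows "vec.subspace (complexification V)"
proof (rule vec.subspaceI)
  have [simp]: "(\<chi> i. Re (x $ i) + Re (y $ i)) = (\<chi> i. Re (x $ i)) + (\<chi> i. Re (y $ i))"
    "(\<chi> i. Im (x $ i) + Im (y $ i)) = (\<chi> i. Im (x $ i)) + (\<chi> i. Im (y $ i))" for x y :: "complex^'n"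
    by (simp_all add: vec_eq_iff)
  have [simp]: "(\<chi> i. Re c * Re (x $ i) - Im c * Im (x $ i)) =
      Re c *\<^sub>R (\<chi> i. Re (x $ i)) - Im c *\<^sub>R (\<chi> i. Im (x $ i))"
    "(\<chi> i. Re c * Im (x $ i) + Im c * Re (x $ i)) =
      Re c *\<^sub>R (\<chi> i. Im (x $ i)) + Im c *\<^sub>R (\<chi> i. Re (x $ i))" for c and x :: "complex^'n"
    by (simp_all add: vec_eq_iff)
  show "0 \<in> complexification V"
    using assms by (simp add: complexification_def subspace_0 zero_vec_def [symmetric])
  show "x + y \<in> complexification V" if "x \<in> complexification V" "y \<in> complexification V" for x y
    using that assms by (simp add: complexification_def subspace_add)
  show "c *s x \<in> complexification V" if "x \<in> complexification V" for c x
    using that assms by (simp add: complexification_def subspace_add subspace_diff subspace_scale)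
qed

lemma spectrum_on_eq:
  "z \<in> spectrum_on M V \<longleftrightarrow> (\<exists>v. v \<noteq> 0 \<and> v \<in> complexification V \<and> cmat M *v v = z *s v)"
  by (auto simp: spectrum_on_def complexification_def cmat_def)

text \<open>Outside the spectrum \<open>M - z\<close> is injective on
  \<open>complexification V\<close> and maps it into itself; finite dimension makes it onto.\<close>

lemma shifted_map_onto_complexification:
  assumes V: "subspace V" and inv: "(\<lambda>x. M *v x) ` V \<subseteq> V" and z: "z \<notin> spectrum_on M V"
    and y: "y \<in> complexification V"
  obtains x where "x \<in> complexification V" "y = cmat M *v x - z *s x"
proof -
  let ?f = "\<lambda>x. cmat M *v x - z *s x" and ?V = "complexification V"
  have lin: "Vector_Spaces.linear (*s) (*s) ?f"
    by unfold_locales (simp_all add: matrix_vector_right_distrib vec_eq_iff algebra_simps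
        matrix_vector_mult_def sum.distrib sum_distrib_left)
  then interpret f: Vector_Spaces.linear "(*s)" "(*s)" ?f .
  note sub = subspace_complexification [OF V]
  have "inj_on ?f (vec.span ?V)"
    using z by (subst f.inj_on_iff_eq_0) (use sub in \<open>auto simp: vec.span_eq_iff [THEN iffD2, OF sub] spectrum_on_eq\<close>)
  then have dim: "vec.dim (?f ` ?V) = vec.dim ?V"
    by (rule vec.dim_image_eq [OF lin])
  have le: "?f ` ?V \<subseteq> ?V"
    using cmat_mult_complexification [OF inv] sub by (auto intro: vec.subspace_diff vec.subspace_scale)
  have "?f ` ?V = ?V"
    by (rule vec.subspace_dim_equal [OF f.subspace_image [OF sub] sub le]) (simp only: dim)
  then have "y \<in> ?f ` ?V" using y by blast
  then show thesis using that by blast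
qed

text \<open>The hypothesis on \<open>seq_act\<close> says that \<open>q\<close> annihilates
  \<open>d(M) x\<close>. Roots of \<open>d\<close> are stripped one by one: if
  \<open>d = (X - z) e\<close>, then \<open>z\<close> is outside the spectrum, so every
  \<open>y\<close> is \<open>(M - z) x\<close> and \<open>e(M) y = d(M) x\<close>. A nonzero
  constant remains.\<close>

lemma functional_vanishes:
  fixes q :: "complex^'n"
  assumes V: "subspace V" and inv: "(\<lambda>x. M *v x) ` V \<subseteq> V"
    and "d \<noteq> 0" "\<And>z. z \<in> spectrum_on M V \<Longrightarrow> poly d z \<noteq> 0"
    and "\<And>x. x \<in> complexification V \<Longrightarrow>
      seq_act d (\<lambda>k. \<Sum>j\<in>UNIV. q $ j * (((*v) (cmat M) ^^ k) x) $ j) = 0"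
    and "x \<in> complexification V"
  shows "(\<Sum>j\<in>UNIV. q $ j * x $ j) = 0"
  using assms(3-)
proof (induction "degree d" arbitrary: d x)
  case 0
  then obtain c where "d = [:c:]" by (metis degree_eq_zeroE)
  then show ?case using 0 by (force simp: seq_act_def)
next
  case (Suc n)
  have "\<not> constant (poly d)" using Suc.hyps(2) by (simp add: constant_degree)
  then obtain z where z: "poly d z = 0"
    using fundamental_theorem_of_algebra by blast
  then obtain e where e: "d = [:-z, 1:] * e" by (auto simp: poly_eq_0_iff_dvd dvd_def)
  with Suc.prems(1) have "e \<noteq> 0" by auto
  show ?case
  proof (rule Suc.hyps(1))
    show "n = degree e" using Suc.hyps(2) unfolding e degree_linear_mult [OF \<open>e \<noteq> 0\<close>] by simp
    show "e \<noteq> 0" by fact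
    show "poly e z \<noteq> 0" if "z \<in> spectrum_on M V" for z
      using Suc.prems(2) [OF that] by (auto simp: e)
    show "x \<in> complexification V" by fact
    fix y assume "y \<in> complexification V"
    then obtain x where x: "x \<in> complexification V" "y = cmat M *v x - z *s x"
      using shifted_map_onto_complexification [OF V inv] Suc.prems(2) z by blast
    have pow: "((*v) (cmat M) ^^ k) y = ((*v) (cmat M) ^^ Suc k) x - z *s ((*v) (cmat M) ^^ k) x" for k
    proof (induction k)
      case 0
      then show ?case by (simp add: x)
    next
      case (Suc k)
      have "((*v) (cmat M) ^^ Suc k) y = cmat M *v (((*v) (cmat M) ^^ Suc k) x - z *s ((*v) (cmat M) ^^ k) x)"
        by (simp add: Suc)
      then show ?case
        by (simp add: matrix_vector_mult_diff_distrib vector_scalar_commute)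
    qed
    have "seq_act e (\<lambda>k. \<Sum>j\<in>UNIV. q $ j * (((*v) (cmat M) ^^ k) y) $ j) =
      seq_act e (\<lambda>k. (\<Sum>j\<in>UNIV. q $ j * (((*v) (cmat M) ^^ Suc k) x) $ j)
        - z * (\<Sum>j\<in>UNIV. q $ j * (((*v) (cmat M) ^^ k) x) $ j))"
      by (simp only: pow vector_minus_component vector_smult_component right_diff_distrib
          sum_subtractf sum_distrib_left mult_ac)
    also have "\<dots> = seq_act d (\<lambda>k. \<Sum>j\<in>UNIV. q $ j * (((*v) (cmat M) ^^ k) x) $ j)"
      unfolding e seq_act_linear_mult seq_act_diff_right by simp
    also have "\<dots> = 0" by (rule Suc.prems(3) [OF x(1)])
    finally show "seq_act e (\<lambda>k. \<Sum>j\<in>UNIV. q $ j * (((*v) (cmat M) ^^ k) y) $ j) = 0" .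
  qed
qed

subsection \<open>The largest stabilizability output-nulling subspace\<close>

text \<open>The state parts of the real kernel of the pencil at \<open>x\<close>. A nonzero member
  becomes a closed-loop eigenvector for \<open>x\<close> with zero output once
  \<open>F v = w\<close>.\<close>

definition null_directions ::
  "real^'n^'n \<Rightarrow> real^'m^'n \<Rightarrow> real^'n^'p \<Rightarrow> real^'m^'p \<Rightarrow> real \<Rightarrow> (real^'n) set" where
  "null_directions A B C D x =
     {v. \<exists>w. (A - mat x) *v v + B *v w = 0 \<and> C *v v + D *v w = 0}"

text \<open>A union and not its span: a vector picked from it must be assignable to one single
  eigenvalue.\<close>

definition stable_null_directions ::
  "time_domain \<Rightarrow> real^'n^'n \<Rightarrow> real^'m^'n \<Rightarrow> real^'n^'p \<Rightarrow> real^'m^'p \<Rightarrow> (real^'n) set" where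
  "stable_null_directions td A B C D =
     (\<Union>x \<in> {x. complex_of_real x \<in> stable_region td}. null_directions A B C D x)"

definition real_semisimple_stable_zeros ::
  "time_domain \<Rightarrow> real^'n^'n \<Rightarrow> real^'m^'n \<Rightarrow> real^'n^'p \<Rightarrow> real^'m^'p \<Rightarrow> bool" where
  "real_semisimple_stable_zeros td A B C D \<longleftrightarrow>
     (\<forall>z \<in> stable_region td. invariant_zero A B C D z \<longrightarrow> z \<in> \<real> \<and>
        zero_alg_mult (system_pencil A B C D) z = zero_geom_mult (system_pencil A B C D) z)"

lemma infinite_stable_reals: "infinite {x. complex_of_real x \<in> stable_region td}"
proof (rule infinite_super)
  show "{-1<..<0::real} \<subseteq> {x. complex_of_real x \<in> stable_region td}"
    by (cases td) auto
qed (simp add: infinite_Ioo)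

lemma mat_mult_vec: "mat x *v v = x *s v" for v :: "'a::comm_ring_1^'n"
  by (simp add: vec_eq_iff matrix_vector_mult_def mat_def if_distrib [of "\<lambda>a. a * _"] cong: if_cong)

text \<open>The kernel of the pencil at \<open>x\<close> projects onto
  \<open>null_directions\<close>, so the row \<open>[q 0]\<close> annihilates this kernel and is a
  real combination of the rows.\<close>

lemma orthogonal_null_directions_row_space:
  assumes "\<And>v. v \<in> null_directions A B C D x \<Longrightarrow> q \<bullet> v = 0"
  shows "\<exists>c. join_vec (cvec q) 0 = c v* eval_pmat (system_pencil A B C D) (of_real x)"
proof -
  let ?Q = "block_matrix (A - mat x) B C D"
  have "join_vec q 0 \<bullet> y = 0" if y: "?Q *v y = 0" for y
  proof -
    obtain v w where vw: "y = join_vec v w" by (rule join_vec_cases)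
    then have "v \<in> null_directions A B C D x"
      using y by (auto simp: block_matrix_mult_join_vec null_directions_def)
    then have "q \<bullet> v = 0" by (rule assms)
    then show ?thesis
      by (simp add: vw join_vec_def inner_vec_def sum_UNIV_sum_type)
  qed
  then obtain c where "join_vec q 0 = c v* ?Q"
    by (rule annihilator_in_row_space)
  then have "join_vec (cvec q) (cvec 0) = cvec c v* cmat ?Q"
    by (simp only: join_vec_cvec cvec_mult_cmat)
  then show ?thesis
    by (metis cvec_eq_0_iff eval_pmat_system_pencil_of_real)
qed

lemma right_invertible_full_rank_point:
  fixes A :: "real^'n^'n" and D :: "real^'m^'p"
  assumes "right_invertible A B C D"
  obtains z where "rank (eval_pmat (system_pencil A B C D) z) = CARD('n + 'p)"
proof -
  have "finite {z. rank (eval_pmat (system_pencil A B C D) z) \<noteq> CARD('n + 'p)}"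
    using assms by (simp add: right_invertible_def)
  then have "{z. rank (eval_pmat (system_pencil A B C D) z) \<noteq> CARD('n + 'p)} \<noteq> UNIV"
    using infinite_UNIV_char_0 by metis
  then show thesis using that by blast
qed

lemma invariant_zero_iff:
  fixes A :: "real^'n^'n" and B :: "real^'m^'n" and C :: "real^'n^'p" and D :: "real^'m^'p"
  assumes "right_invertible A B C D"
  shows "invariant_zero A B C D z \<longleftrightarrow> rank (eval_pmat (system_pencil A B C D) z) \<noteq> CARD('n + 'p)"
proof -
  have "normal_rank (system_pencil A B C D) = CARD('n + 'p)"
    using right_invertible_full_rank_point [OF assms] normal_rank_full by metis
  then show ?thesis
    using rank_le_rows [of "eval_pmat (system_pencil A B C D) z"] unfolding invariant_zero_def by linarith
qed

text \<open>Reality and semisimplicity of the stable zeros enter here: once common factors are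
  removed, they exclude stable zeros of \<open>d\<close>.\<close>

lemma stable_row_certificate:
  fixes A :: "real^'n^'n" and B :: "real^'m^'n" and C :: "real^'n^'p" and D :: "real^'m^'p"
  assumes ri: "right_invertible A B C D"
    and zeros: "real_semisimple_stable_zeros td A B C D"
    and orth: "\<And>v. v \<in> stable_null_directions td A B C D \<Longrightarrow> q \<bullet> v = 0"
  shows "\<exists>(a :: complex poly^('n + 'p)) d. d \<noteq> 0 \<and> (\<forall>z \<in> stable_region td. poly d z \<noteq> 0) \<and>
    (\<forall>j. (a v* system_pencil A B C D) $ j = smult (join_vec (cvec q) 0 $ j) d)"
proof -
  define P where "P = system_pencil A B C D"
  define Q where "Q = join_vec (cvec q) (0 :: complex^'m)"
  have row: "\<exists>c. Q = c v* eval_pmat P (of_real x)" if "complex_of_real x \<in> stable_region td" for x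
    unfolding P_def Q_def
    by (rule orthogonal_null_directions_row_space) (use orth that in \<open>auto simp: stable_null_directions_def\<close>)
  obtain z0 where z0: "rank (eval_pmat P z0) = CARD('n + 'p)"
    using right_invertible_full_rank_point [OF ri] unfolding P_def by metis
  have "infinite (complex_of_real ` {x. complex_of_real x \<in> stable_region td})"
    using infinite_stable_reals by (simp add: finite_image_iff inj_on_def)
  then have "infinite {z. \<exists>c. Q = c v* eval_pmat P z}"
    by (rule infinite_super [rotated]) (auto simp: row)
  then obtain a0 :: "complex poly^('n + 'p)" and d0 where "d0 \<noteq> 0" "\<And>j. (a0 v* P) $ j = smult (Q $ j) d0"
    using polynomial_row_certificate [OF _ z0] by metis
  then obtain a :: "complex poly^('n + 'p)" and d where "d \<noteq> 0" and ad: "\<And>j. (a v* P) $ j = smult (Q $ j) d"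
    and prim: "\<And>z. poly d z = 0 \<Longrightarrow> \<exists>i. poly (a $ i) z \<noteq> 0"
    using primitive_row_certificate [of d0 a0 P Q] by metis
  have "poly d z \<noteq> 0" if z: "z \<in> stable_region td" for z
  proof
    assume dz: "poly d z = 0"
    define az where "az = (\<chi> i. poly (a $ i) z)"
    have "az \<noteq> 0" using prim [OF dz] by (auto simp: az_def vec_eq_iff)
    have "az v* eval_pmat P z = 0"
      by (simp add: vec_eq_iff az_def poly_vector_matrix_mult [symmetric] ad dz)
    with \<open>az \<noteq> 0\<close> have "rank (eval_pmat P z) \<noteq> CARD('n + 'p)"
      unfolding full_row_rank_iff by blast
    then have iz: "invariant_zero A B C D z"
      unfolding invariant_zero_iff [OF ri] P_def .
    \<comment> \<open>Row-space membership is known only at real stable points; since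
      \<open>z\<close> is real it holds at \<open>z\<close> itself, although the rank drops
      there.\<close>
    then obtain x where x: "z = of_real x" using zeros iz z unfolding real_semisimple_stable_zeros_def by (metis Reals_cases)
    then obtain c where c: "Q = c v* eval_pmat P z" using row z by blast
    \<comment> \<open>Subtracting \<open>d\<close> times the constant row \<open>c\<close> from
      \<open>a\<close> leaves \<open>r P = d (Q - c P)\<close>, a product of two factors that both
      vanish at \<open>z\<close>.\<close>
    define k where "k = (\<chi> i. [:c $ i:])"
    define r where "r = (\<chi> i. a $ i - smult (c $ i) d)"
    have "[:-z, 1:] ^ 2 dvd (r v* P) $ j" for j
    proof -
      have "poly ((k v* P) $ j - [:Q $ j:]) z = 0"
        by (simp add: poly_vector_matrix_mult k_def c)
      then have "[:-z, 1:] dvd (k v* P) $ j - [:Q $ j:]"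
        by (simp only: poly_eq_0_iff_dvd)
      moreover have "[:-z, 1:] dvd d" using dz by (simp only: poly_eq_0_iff_dvd)
      moreover have "(r v* P) $ j = - (d * ((k v* P) $ j - [:Q $ j:]))"
      proof -
        have "(r v* P) $ j = (a v* P) $ j - d * (k v* P) $ j"
          by (simp add: r_def k_def vector_matrix_mult_def algebra_simps sum_subtractf sum_distrib_left)
        then show ?thesis by (simp add: ad algebra_simps)
      qed
      ultimately show ?thesis
        unfolding power2_eq_square by (metis dvd_minus_iff mult_dvd_mono)
    qed
    moreover have "zero_alg_mult P z = zero_geom_mult P z"
      using zeros iz z unfolding real_semisimple_stable_zeros_def P_def by blast
    ultimately have "poly (r $ i) z = 0" for i
      using semisimple_zero [OF z0] by metis
    \<comment> \<open>As \<open>d\<close> vanishes at \<open>z\<close>, the rows \<open>r\<close>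
      and \<open>a\<close> have the same value there.\<close>
    then have "az = 0" by (simp add: vec_eq_iff r_def az_def dz)
    with \<open>az \<noteq> 0\<close> show False ..
  qed
  with \<open>d \<noteq> 0\<close> ad show ?thesis unfolding P_def Q_def by blast
qed

section \<open>Vanishing along output-nulling trajectories\<close>

lemma system_pencil_entry:
  "system_pencil A B C D $ i $ j =
    [:block_matrix (cmat A) (cmat B) (cmat C) (cmat D) $ i $ j, block_matrix (- mat 1) 0 0 0 $ i $ j:]"
  by (auto simp: system_pencil_def block_matrix_def cmat_def mat_def split: sum.splits)

text \<open>With its variable read as the shift, the pencil annihilates the joined sequence
  \<open>\<xi>\<close>; so does \<open>a\<close> times the pencil, which is \<open>d\<close> times
  \<open>[q 0]\<close>. The index \<open>k\<close> is purely algebraic, so one argument covers both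
  time domains.\<close>

lemma seq_act_pencil_trajectory:
  fixes A :: "real^'n^'n" and B :: "real^'m^'n" and C :: "real^'n^'p" and D :: "real^'m^'p"
    and q :: "complex^'n"
  assumes step: "\<And>k. cmat A *v x k + cmat B *v u k = x (Suc k)"
    and out: "\<And>k. cmat C *v x k + cmat D *v u k = 0"
    and ad: "\<And>j. (a v* system_pencil A B C D) $ j = smult (join_vec q 0 $ j) d"
  shows "seq_act d (\<lambda>k. \<Sum>j\<in>UNIV. q $ j * x k $ j) = 0"
proof -
  define \<xi> where "\<xi> = (\<lambda>k. join_vec (x k) (u k))"
  define P0 where "P0 = block_matrix (cmat A) (cmat B) (cmat C) (cmat D)"
  define P1 where "P1 = (block_matrix (- mat 1) 0 0 0 :: complex^('n + 'm)^('n + 'p))"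
  \<comment> \<open>The leading coefficient \<open>P1\<close> contributes \<open>- x (Suc k)\<close>
    in the state rows and nothing in the output rows.\<close>
  have "P0 *v \<xi> k + P1 *v \<xi> (Suc k) = 0" for k
    using step [of k] out [of k]
    by (simp add: P0_def P1_def \<xi>_def block_matrix_mult_join_vec)
      (auto simp: join_vec_def vec_eq_iff matrix_vector_mult_def mat_def sum_negf
        if_distrib [of "\<lambda>a. a * _"] split: sum.splits cong: if_cong)
  then have zero: "(\<Sum>j\<in>UNIV. P0 $ i $ j * \<xi> k $ j) + (\<Sum>j\<in>UNIV. P1 $ i $ j * \<xi> (Suc k) $ j) = 0" for i k
    by (simp add: vec_eq_iff matrix_vector_mult_def)
  have "(\<Sum>j\<in>UNIV. seq_act ((a v* system_pencil A B C D) $ j) (\<lambda>k. \<xi> k $ j)) =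
    (\<Sum>j\<in>UNIV. \<Sum>i\<in>UNIV. P0 $ i $ j * seq_act (a $ i) (\<lambda>k. \<xi> k $ j) +
       P1 $ i $ j * seq_act (a $ i) (\<lambda>k. \<xi> (Suc k) $ j))"
    by (simp only: vector_matrix_mult_def vec_lambda_beta seq_act_sum system_pencil_entry
        mult.commute [of "a $ _"] seq_act_linear_mult P0_def P1_def)
  also have "\<dots> = (\<Sum>i\<in>UNIV. \<Sum>j\<in>UNIV. P0 $ i $ j * seq_act (a $ i) (\<lambda>k. \<xi> k $ j) +
       P1 $ i $ j * seq_act (a $ i) (\<lambda>k. \<xi> (Suc k) $ j))"
    by (rule sum.swap)
  also have "\<dots> = (\<Sum>i\<in>UNIV. seq_act (a $ i) (\<lambda>k. \<Sum>j\<in>UNIV. P0 $ i $ j * \<xi> k $ j) +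
       seq_act (a $ i) (\<lambda>k. \<Sum>j\<in>UNIV. P1 $ i $ j * \<xi> (Suc k) $ j))"
    by (simp only: seq_act_sum_right sum.distrib)
  also have "\<dots> = (\<Sum>i\<in>UNIV. seq_act (a $ i)
      (\<lambda>k. (\<Sum>j\<in>UNIV. P0 $ i $ j * \<xi> k $ j) + (\<Sum>j\<in>UNIV. P1 $ i $ j * \<xi> (Suc k) $ j)))"
    by (simp only: seq_act_def distrib_left sum.distrib)
  also have "\<dots> = 0" by (simp only: zero) (simp add: seq_act_def)
  finally have "(\<Sum>j\<in>UNIV. join_vec q 0 $ j * seq_act d (\<lambda>k. \<xi> k $ j)) = 0"
    by (simp only: ad seq_act_smult)
  then show ?thesis
    by (simp add: seq_act_sum_right sum_UNIV_sum_type join_vec_def \<xi>_def)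
qed

lemma cmat_closed_loop: "cmat (A + B ** F) *v x = cmat A *v x + cmat B *v (cmat F *v x)"
proof -
  have "cmat (A + B ** F) = cmat A + cmat B ** cmat F"
    by (simp add: vec_eq_iff cmat_def matrix_matrix_mult_def)
  then show ?thesis
    by (simp add: matrix_vector_mult_add_rdistrib matrix_vector_mul_assoc)
qed

text \<open>With \<open>q\<close> the component of \<open>x\<close> orthogonal to the span,
  \<open>q \<bullet> x = q \<bullet> q\<close>, so it suffices that \<open>q\<close> annihilates
  \<open>x\<close>. The certificate is applied along the iterates of the closed loop, whose inputs
  are given by \<open>F\<close>.\<close>

lemma stabilizability_output_nulling_le:
  fixes A :: "real^'n^'n" and B :: "real^'m^'n" and C :: "real^'n^'p" and D :: "real^'m^'p"
  assumes ri: "right_invertible A B C D"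
    and zeros: "real_semisimple_stable_zeros td A B C D"
    and V: "stabilizability_output_nulling td A B C D V"
  shows "V \<subseteq> span (stable_null_directions td A B C D)"
proof
  fix x assume "x \<in> V"
  obtain F where sub: "subspace V" and inv: "(\<lambda>x. (A + B ** F) *v x) ` V \<subseteq> V"
    and ker: "V \<subseteq> {x. (C + D ** F) *v x = 0}"
    and spec: "spectrum_on (A + B ** F) V \<subseteq> stable_region td"
    using V unfolding stabilizability_output_nulling_def by blast
  obtain s q where s: "s \<in> span (stable_null_directions td A B C D)"
    and q: "\<And>w. w \<in> span (stable_null_directions td A B C D) \<Longrightarrow> orthogonal q w" and "x = s + q"
    using orthogonal_subspace_decomp_exists [of "stable_null_directions td A B C D" x] by metis
  have orth: "q \<bullet> v = 0" if "v \<in> stable_null_directions td A B C D" for v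
    using q [OF span_base [OF that]] by (simp add: orthogonal_def)
  obtain a :: "complex poly^('n + 'p)" and d where d: "d \<noteq> 0" "\<And>z. z \<in> stable_region td \<Longrightarrow> poly d z \<noteq> 0"
    and ad: "\<And>j. (a v* system_pencil A B C D) $ j = smult (join_vec (cvec q) 0 $ j) d"
    using stable_row_certificate [OF ri zeros orth] by blast
  let ?M = "(*v) (cmat (A + B ** F))"
  have "seq_act d (\<lambda>k. \<Sum>j\<in>UNIV. cvec q $ j * (?M ^^ k) y $ j) = 0"
    if y: "y \<in> complexification V" for y
  proof (rule seq_act_pencil_trajectory [OF _ _ ad])
    fix k
    have "(?M ^^ k) y \<in> complexification V"
      by (induction k) (use y cmat_mult_complexification [OF inv] in auto)
    then have "cmat (C + D ** F) *v (?M ^^ k) y = 0"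
      by (rule cmat_kernel_complexification [OF ker])
    then show "cmat C *v (?M ^^ k) y + cmat D *v (cmat F *v (?M ^^ k) y) = 0"
      by (simp add: cmat_closed_loop)
    show "cmat A *v (?M ^^ k) y + cmat B *v (cmat F *v (?M ^^ k) y) = (?M ^^ Suc k) y"
      by (simp add: cmat_closed_loop)
  qed
  then have "(\<Sum>j\<in>UNIV. cvec q $ j * cvec x $ j) = 0"
    using d(2) spec \<open>x \<in> V\<close> cvec_in_complexification [OF sub]
    by (intro functional_vanishes [OF sub inv d(1)]) auto
  then have "complex_of_real (q \<bullet> x) = 0"
    by (simp add: cvec_def inner_vec_def)
  then have "q \<bullet> q = 0"
    using q [OF s] \<open>x = s + q\<close> by (simp add: inner_add_right orthogonal_def)
  then show "x \<in> span (stable_null_directions td A B C D)" using s \<open>x = s + q\<close> by simp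
qed

text \<open>In coordinates with respect to \<open>E\<close> the eigenvalue equation decouples into
  \<open>(\<mu> b - z)\<close> times the \<open>b\<close>-th coordinate being zero; real and
  imaginary parts are treated as two real vectors.\<close>

lemma spectrum_on_span_eigenvectors:
  fixes M :: "real^'n^'n"
  assumes ind: "independent E" and eig: "\<And>b. b \<in> E \<Longrightarrow> M *v b = \<mu> b *s b"
  shows "spectrum_on M (span E) \<subseteq> (\<lambda>b. complex_of_real (\<mu> b)) ` E"
proof
  fix z assume "z \<in> spectrum_on M (span E)"
  then obtain v :: "complex^'n" where v: "v \<noteq> 0" "v \<in> complexification (span E)" "cmat M *v v = z *s v"
    by (auto simp: spectrum_on_eq)
  define x where "x = (\<chi> i. Re (v $ i))"
  define y where "y = (\<chi> i. Im (v $ i))"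
  have xy: "x \<in> span E" "y \<in> span E" using v(2) by (auto simp: complexification_def x_def y_def)
  have Mx: "M *v x = Re z *\<^sub>R x - Im z *\<^sub>R y" and My: "M *v y = Re z *\<^sub>R y + Im z *\<^sub>R x"
    unfolding x_def y_def Re_cmat_mult [symmetric] Im_cmat_mult [symmetric] v(3)
    by (simp_all add: vec_eq_iff)
  have fin: "finite E" using ind by (rule independent_imp_finite)
  let ?r = "representation E"
  have expand: "w = (\<Sum>b\<in>E. ?r w b *\<^sub>R b)" if "w \<in> span E" for w
    using sum_representation_eq [OF ind that fin order_refl] by simp
  have Mexpand: "M *v w = (\<Sum>b\<in>E. (\<mu> b * ?r w b) *\<^sub>R b)" if "w \<in> span E" for w
  proof -
    have "M *v w = (\<Sum>b\<in>E. ?r w b *\<^sub>R (M *v b))"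
      by (subst expand [OF that])
        (simp add: linear_sum [OF matrix_vector_mul_linear] linear_cmul [OF matrix_vector_mul_linear])
    then show ?thesis by (simp add: eig scalar_mult_eq_scaleR mult.commute)
  qed
  have coeff: "\<forall>b\<in>E. c b = 0" if "(\<Sum>b\<in>E. c b *\<^sub>R b) = 0" for c
    using ind that by (simp add: independent_explicit)
  have "(\<Sum>b\<in>E. (\<mu> b * ?r x b - (Re z * ?r x b - Im z * ?r y b)) *\<^sub>R b) = 
      M *v x - (Re z *\<^sub>R (\<Sum>b\<in>E. ?r x b *\<^sub>R b) - Im z *\<^sub>R (\<Sum>b\<in>E. ?r y b *\<^sub>R b))"
    by (simp add: Mexpand xy scaleR_diff_left sum_subtractf scaleR_sum_right)
  also have "\<dots> = 0" using Mx expand [OF xy(1)] expand [OF xy(2)] by simp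
  finally have 1: "\<forall>b\<in>E. \<mu> b * ?r x b - (Re z * ?r x b - Im z * ?r y b) = 0" by (rule coeff)
  have "(\<Sum>b\<in>E. (\<mu> b * ?r y b - (Re z * ?r y b + Im z * ?r x b)) *\<^sub>R b) = 
      M *v y - (Re z *\<^sub>R (\<Sum>b\<in>E. ?r y b *\<^sub>R b) + Im z *\<^sub>R (\<Sum>b\<in>E. ?r x b *\<^sub>R b))"
    by (simp add: Mexpand xy scaleR_diff_left scaleR_add_left sum.distrib sum_subtractf scaleR_sum_right)
  also have "\<dots> = 0" using My expand [OF xy(1)] expand [OF xy(2)] by simp
  finally have 2: "\<forall>b\<in>E. \<mu> b * ?r y b - (Re z * ?r y b + Im z * ?r x b) = 0" by (rule coeff)
  have "\<exists>b\<in>E. ?r x b \<noteq> 0 \<or> ?r y b \<noteq> 0"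
  proof (rule ccontr)
    assume "\<not> ?thesis"
    then have "x = 0" "y = 0" using expand [OF xy(1)] expand [OF xy(2)] by simp_all
    then have "v = 0" by (simp add: x_def y_def vec_eq_iff complex_eq_iff)
    with v(1) show False ..
  qed
  then obtain b where b: "b \<in> E" "?r x b \<noteq> 0 \<or> ?r y b \<noteq> 0" by blast
  have e1: "(\<mu> b - Re z) * ?r x b = - Im z * ?r y b" and e2: "(\<mu> b - Re z) * ?r y b = Im z * ?r x b"
    using 1 2 b(1) by (auto simp: algebra_simps)
  \<comment> \<open>Multiplicativity of the squared modulus, for \<open>\<mu> b - z\<close> and the
    complex coordinate of \<open>v\<close> at \<open>b\<close>.\<close>
  have "((\<mu> b - Re z)\<^sup>2 + (Im z)\<^sup>2) * ((?r x b)\<^sup>2 + (?r y b)\<^sup>2) =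
      ((\<mu> b - Re z) * ?r x b + Im z * ?r y b)\<^sup>2 + ((\<mu> b - Re z) * ?r y b - Im z * ?r x b)\<^sup>2"
    by (simp add: power2_eq_square algebra_simps)
  also have "\<dots> = 0" using e1 e2 by simp
  finally have "\<mu> b = Re z \<and> Im z = 0"
    using b(2) by (auto simp: sum_power2_eq_zero_iff)
  then have "z = complex_of_real (\<mu> b)" by (simp add: complex_eq_iff)
  with b(1) show "z \<in> (\<lambda>b. complex_of_real (\<mu> b)) ` E" by blast
qed

text \<open>The span is itself admissible, since one feedback turns a basis of null directions into
  closed-loop eigenvectors; the preceding inclusion makes it the greatest such subspace.\<close>

lemma V_star_g_eq:
  fixes A :: "real^'n^'n" and B :: "real^'m^'n" and C :: "real^'n^'p" and D :: "real^'m^'p"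
  assumes ri: "right_invertible A B C D"
    and zeros: "real_semisimple_stable_zeros td A B C D"
  shows "V_star_g td A B C D = span (stable_null_directions td A B C D)"
  unfolding V_star_g_def
proof (rule Greatest_equality)
  let ?N = "stable_null_directions td A B C D"
  obtain E where E: "E \<subseteq> ?N" "independent E" "?N \<subseteq> span E"
    using basis_exists [of ?N] by metis
  have span: "span ?N = span E"
    using span_mono [OF E(1)] span_minimal [OF E(3)] by auto
  have "\<forall>b\<in>E. \<exists>x. complex_of_real x \<in> stable_region td \<and> b \<in> null_directions A B C D x"
    using E(1) by (auto simp: stable_null_directions_def)
  then obtain \<mu> where \<mu>: "\<forall>b\<in>E. complex_of_real (\<mu> b) \<in> stable_region td \<and>
      b \<in> null_directions A B C D (\<mu> b)"
    by (rule bchoice [THEN exE])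
  then have "\<forall>b\<in>E. \<exists>w. (A - mat (\<mu> b)) *v b + B *v w = 0 \<and> C *v b + D *v w = 0"
    by (simp add: null_directions_def)
  then obtain w where w: "\<forall>b\<in>E. (A - mat (\<mu> b)) *v b + B *v w b = 0 \<and> C *v b + D *v w b = 0"
    by (rule bchoice [THEN exE])
  \<comment> \<open>The feedback is prescribed on the basis \<open>E\<close> by the inputs
    \<open>w\<close>; outside the span of \<open>E\<close> any linear extension will do.\<close>
  obtain f where f: "linear f" "\<And>b. b \<in> E \<Longrightarrow> f b = w b"
    using linear_independent_extend [OF E(2), of w] by auto
  define F where "F = matrix f"
  have F: "F *v b = w b" if "b \<in> E" for b
    using f that by (simp add: F_def matrix_works)
  have eig: "(A + B ** F) *v b = \<mu> b *s b" and out: "(C + D ** F) *v b = 0" if "b \<in> E" for b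
    using bspec [OF w that]
    by (simp_all add: F that matrix_vector_mult_add_rdistrib matrix_vector_mult_diff_rdistrib mat_mult_vec algebra_simps
        flip: matrix_vector_mul_assoc)
  show "stabilizability_output_nulling td A B C D (span ?N)"
    unfolding stabilizability_output_nulling_def span
  proof (intro conjI exI)
    show "subspace (span E)" by simp
    have "((*v) (A + B ** F)) ` span E = span ((*v) (A + B ** F) ` E)"
      by (rule linear_span_image [symmetric]) simp
    also have "\<dots> \<subseteq> span E"
      by (rule span_minimal) (auto simp: eig scalar_mult_eq_scaleR intro: span_scale span_base)
    finally show "((*v) (A + B ** F)) ` span E \<subseteq> span E" .
    have "subspace {x. (C + D ** F) *v x = 0}"
      by (rule linear_subspace_kernel) simp
    then show "span E \<subseteq> {x. (C + D ** F) *v x = 0}"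
      by (intro span_minimal) (auto simp: out)
    show "spectrum_on (A + B ** F) (span E) \<subseteq> stable_region td"
      using spectrum_on_span_eigenvectors [OF E(2), of "A + B ** F" \<mu>] eig \<mu> by blast
  qed
qed (rule stabilizability_output_nulling_le [OF ri zeros])

subsection \<open>Independent transversals\<close>

lemma dim_Un_cong:
  assumes "span X = span Y"
  shows "dim (X \<union> Z) = dim (Y \<union> Z)"
proof -
  have "span (X \<union> Z) = span (Y \<union> Z)" using assms by (simp only: span_Un)
  then show ?thesis by (metis dim_span)
qed

text \<open>Ranks are taken modulo the fixed set \<open>U\<close>; this replaces the passage to quotients in the
  Halmos--Vaughan style induction, which splits at a tight proper subfamily if there is one.\<close>

lemma Rado_transversal_relative:
  fixes \<A> :: "'k \<Rightarrow> 'a::euclidean_space set"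
  assumes "finite K"
    and "\<And>J. J \<subseteq> K \<Longrightarrow> dim U + card J \<le> dim (U \<union> (\<Union>k\<in>J. \<A> k))"
  shows "\<exists>v. (\<forall>k\<in>K. v k \<in> \<A> k) \<and> dim U + card K \<le> dim (U \<union> v ` K)"
  using assms
proof (induction K arbitrary: U rule: finite_psubset_induct)
  case (psubset K)
  note rank = psubset.prems
  consider "K = {}"
    | (tight) J where "J \<subset> K" "J \<noteq> {}" "dim (U \<union> (\<Union>k\<in>J. \<A> k)) \<le> dim U + card J"
    | (slack) "K \<noteq> {}" "\<And>J. J \<subset> K \<Longrightarrow> J \<noteq> {} \<Longrightarrow> dim U + card J < dim (U \<union> (\<Union>k\<in>J. \<A> k))"
    using not_le by metis
  then show ?case
  proof cases
    case 1
    then show ?thesis by simp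
  next
    \<comment> \<open>The tight subfamily is solved first. Together with \<open>U\<close> its
      transversal spans all that \<open>U\<close> and the sets of \<open>J\<close> span, so it may
      replace them, and the remaining sets satisfy the rank condition modulo the enlarged
      \<open>U\<close>.\<close>
    case tight
    have JK: "J \<subseteq> K" using tight(1) by blast
    have "\<And>J'. J' \<subseteq> J \<Longrightarrow> dim U + card J' \<le> dim (U \<union> (\<Union>k\<in>J'. \<A> k))"
      using rank JK by blast
    from psubset.IH [OF tight(1) this] obtain v1 where v1: "\<forall>k\<in>J. v1 k \<in> \<A> k"
      "dim U + card J \<le> dim (U \<union> v1 ` J)" by blast
    have "U \<union> v1 ` J \<subseteq> U \<union> (\<Union>k\<in>J. \<A> k)" using v1(1) by blast
    moreover have "dim (U \<union> (\<Union>k\<in>J. \<A> k)) \<le> dim (U \<union> v1 ` J)"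
      using tight(3) v1(2) by linarith
    ultimately have span: "span (U \<union> v1 ` J) = span (U \<union> (\<Union>k\<in>J. \<A> k))"
      by (rule dim_eq_span)
    then have dimJ: "dim (U \<union> v1 ` J) = dim U + card J"
      using tight(3) v1(2) by (metis dim_span order_antisym)
    have "dim (U \<union> v1 ` J) + card J' \<le> dim ((U \<union> v1 ` J) \<union> (\<Union>k\<in>J'. \<A> k))"
      if J': "J' \<subseteq> K - J" for J'
    proof -
      have "finite J" "finite J'" using psubset.hyps JK J' by (auto intro: finite_subset)
      then have "card (J \<union> J') = card J + card J'"
        using J' by (intro card_Un_disjoint) auto
      moreover have "dim U + card (J \<union> J') \<le> dim (U \<union> (\<Union>k\<in>J \<union> J'. \<A> k))"
        using JK J' by (intro rank) auto
      moreover have "U \<union> (\<Union>k\<in>J \<union> J'. \<A> k) = (U \<union> (\<Union>k\<in>J. \<A> k)) \<union> (\<Union>k\<in>J'. \<A> k)" by auto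
      ultimately show ?thesis by (simp only: dimJ dim_Un_cong [OF span])
    qed
    moreover have "K - J \<subset> K" using tight(1,2) by blast
    ultimately obtain v2 where v2: "\<forall>k\<in>K - J. v2 k \<in> \<A> k"
      "dim (U \<union> v1 ` J) + card (K - J) \<le> dim ((U \<union> v1 ` J) \<union> v2 ` (K - J))"
      using psubset.IH [of "K - J" "U \<union> v1 ` J"] by blast
    define v where "v = (\<lambda>k. if k \<in> J then v1 k else v2 k)"
    have "(U \<union> v1 ` J) \<union> v2 ` (K - J) = U \<union> v ` K"
      using JK by (auto simp: v_def)
    moreover have "card (K - J) + card J = card K"
      using psubset.hyps JK by (metis card_Diff_subset card_mono finite_subset le_add_diff_inverse2)
    ultimately have "dim U + card K \<le> dim (U \<union> v ` K)"
      using v2(2) dimJ by simp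
    moreover have "\<forall>k\<in>K. v k \<in> \<A> k" using v1(1) v2(1) by (auto simp: v_def)
    ultimately show ?thesis by blast
  next
    \<comment> \<open>Every nonempty proper subfamily has a dimension to spare, so any
      \<open>x\<close> in one set and outside the span of \<open>U\<close> can be added to
      \<open>U\<close> without violating the condition for the others.\<close>
    case slack
    then obtain k0 where k0: "k0 \<in> K" by blast
    have "dim U < dim (U \<union> \<A> k0)" using rank [of "{k0}"] k0 by simp
    moreover have "dim (U \<union> \<A> k0) \<le> dim (span U)" if "\<A> k0 \<subseteq> span U"
      using that by (intro dim_subset Un_least span_superset)
    ultimately have "\<not> \<A> k0 \<subseteq> span U" by (metis dim_span not_le)
    then obtain x where x: "x \<in> \<A> k0" "x \<notin> span U" by blast
    have dimx: "dim (insert x U) = dim U + 1" using x(2) by (simp add: dim_insert)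
    have "dim (insert x U) + card J \<le> dim (insert x U \<union> (\<Union>k\<in>J. \<A> k))" if J: "J \<subseteq> K - {k0}" for J
    proof (cases "J = {}")
      case False
      have "dim U + card J < dim (U \<union> (\<Union>k\<in>J. \<A> k))"
        using slack(2) [OF _ False] J k0 by blast
      also have "\<dots> \<le> dim (insert x U \<union> (\<Union>k\<in>J. \<A> k))" by (rule dim_subset) auto
      finally show ?thesis using dimx by simp
    qed simp
    moreover have "K - {k0} \<subset> K" using k0 by blast
    ultimately obtain v where v: "\<forall>k\<in>K - {k0}. v k \<in> \<A> k"
      "dim (insert x U) + card (K - {k0}) \<le> dim (insert x U \<union> v ` (K - {k0}))"
      using psubset.IH [of "K - {k0}" "insert x U"] by blast
    have "insert x U \<union> v ` (K - {k0}) = U \<union> (v(k0 := x)) ` K" using k0 by auto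
    moreover have "card K = Suc (card (K - {k0}))"
      by (rule card.remove [OF psubset.hyps k0])
    ultimately have "dim U + card K \<le> dim (U \<union> (v(k0 := x)) ` K)"
      using v(2) dimx by simp
    moreover have "\<forall>k\<in>K. (v(k0 := x)) k \<in> \<A> k" using v(1) x(1) by simp
    ultimately show ?thesis by blast
  qed
qed

text \<open>Dimension and cardinality of the image of \<open>K\<close> are at most
  \<open>card K\<close>; the relative version with empty \<open>U\<close> forces equality in both,
  that is, independence and injectivity.\<close>

lemma Rado_transversal:
  fixes \<A> :: "'k \<Rightarrow> 'a::euclidean_space set"
  assumes "finite K" and "\<And>J. J \<subseteq> K \<Longrightarrow> card J \<le> dim (\<Union>k\<in>J. \<A> k)"
  obtains v where "\<And>k. k \<in> K \<Longrightarrow> v k \<in> \<A> k" "inj_on v K" "independent (v ` K)"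
proof -
  obtain v where v: "\<forall>k\<in>K. v k \<in> \<A> k" "card K \<le> dim (v ` K)"
    using Rado_transversal_relative [of K "{}" \<A>] assms by auto
  have fin: "finite (v ` K)" using assms(1) by simp
  have "dim (v ` K) \<le> card (v ` K)" using fin by (rule dim_le_card')
  with v(2) card_image_le [OF assms(1), of v]
  have eq: "card (v ` K) = card K" "card (v ` K) = dim (v ` K)" by auto
  then have "inj_on v K" by (intro eq_card_imp_inj_on assms(1))
  moreover have "independent (v ` K)"
    using card_eq_dim [OF order_refl eq(2) fin] by (simp add: span_superset)
  ultimately show thesis using v(1) that by blast
qed

lemma span_plus_span: "span X + span Y = span (X \<union> Y)" for X Y :: "'a::real_vector set"
  by (auto simp: set_plus_def span_Un)

text \<open>Sums of sets are Minkowski sums; the empty one is \<open>{0}\<close>, the span of the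
  empty set.\<close>

lemma sum_span: "finite P \<Longrightarrow> (\<Sum>p\<in>P. span (f p)) = span (\<Union>p\<in>P. f p)"
  for f :: "'k \<Rightarrow> 'a::real_vector set"
  by (induction P rule: finite_induct) (simp_all add: span_plus_span set_zero)

subsection \<open>Tracking\<close>

text \<open>The image of a transversal, with the feedback built from it, is an instance. A real
  eigenbasis reduces stability and decay to scalar equations.\<close>

locale stable_eigenbasis =
  fixes td :: time_domain and M :: "real^'n^'n" and E :: "(real^'n) set" and \<mu> :: "real^'n \<Rightarrow> real"
  assumes ind: "independent E" and span: "span E = UNIV"
    and eig: "\<And>b. b \<in> E \<Longrightarrow> M *v b = \<mu> b *s b"
    and stable: "\<And>b. b \<in> E \<Longrightarrow> complex_of_real (\<mu> b) \<in> stable_region td"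
begin

lemma finite_E: "finite E"
  using ind by (rule independent_imp_finite)

lemma spectrum_stable: "spectrum M \<subseteq> stable_region td"
  using spectrum_on_span_eigenvectors [OF ind, of M \<mu>] eig stable span
  unfolding spectrum_def by auto

text \<open>A kernel vector would be an eigenvector for 0 or 1 respectively, and neither point is in
  the corresponding open stable region.\<close>

lemma invertible_dc: "invertible (mat (dc_point td) - M)"
proof -
  have "x = 0" if "(mat (dc_point td) - M) *v x = 0" for x
  proof (rule ccontr)
    assume "x \<noteq> 0"
    have "M *v x = dc_point td *s x"
      using that by (simp add: matrix_vector_mult_diff_rdistrib mat_mult_vec)
    then have "cmat M *v cvec x = of_real (dc_point td) *s cvec x"
      by (simp add: cmat_mult_cvec) (simp add: cvec_def vec_eq_iff)
    moreover have "cvec x \<in> complexification UNIV" by (simp add: complexification_def)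
    ultimately have "of_real (dc_point td) \<in> spectrum M"
      using \<open>x \<noteq> 0\<close> unfolding spectrum_def spectrum_on_eq by (metis cvec_eq_0_iff)
    then have "of_real (dc_point td) \<in> stable_region td" using spectrum_stable by blast
    then show False by (cases td) auto
  qed
  then show ?thesis
    by (simp add: invertible_left_inverse matrix_left_invertible_ker)
qed

definition coord :: "real^'n \<Rightarrow> real^'n \<Rightarrow> real" where
  "coord b x = representation E x b"

lemma bounded_linear_coord: "bounded_linear (coord b)"
  unfolding linear_conv_bounded_linear [symmetric] coord_def
  by (rule linearI) (simp_all add: representation_add representation_scale ind span)

lemma coord_expansion: "x = (\<Sum>b\<in>E. coord b x *\<^sub>R b)"
  unfolding coord_def using sum_representation_eq [OF ind _ finite_E order_refl, of x] span by simp

text \<open>Both sides are linear in \<open>x\<close> and agree on the basis.\<close>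

lemma coord_mult:
  assumes "b \<in> E"
  shows "coord b (M *v x) = \<mu> b * coord b x"
proof -
  have lin: "linear (coord b)" using bounded_linear_coord by (rule bounded_linear.linear)
  have "linear (\<lambda>x. coord b (M *v x))"
    using linear_compose [OF matrix_vector_mul_linear lin] by (simp add: o_def)
  moreover have "linear (\<lambda>x. \<mu> b * coord b x)"
    using linear_compose_scale_right [OF lin, of "\<mu> b"] by simp
  moreover have "coord b (M *v b') = \<mu> b * coord b b'" if "b' \<in> E" for b'
    using that by (simp add: eig scalar_mult_eq_scaleR linear_cmul [OF lin])
      (simp add: coord_def representation_basis [OF ind])
  ultimately show ?thesis
    using linear_eq_on_span [of _ _ E x] span by blast
qed

lemma tendsto_zero_if_coords:
  assumes "\<And>b. b \<in> E \<Longrightarrow> ((\<lambda>t. coord b (e t)) \<longlongrightarrow> 0) \<F>"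
  shows "(e \<longlongrightarrow> 0) \<F>"
proof -
  have "((\<lambda>t. \<Sum>b\<in>E. coord b (e t) *\<^sub>R b) \<longlongrightarrow> (\<Sum>b\<in>E. 0 *\<^sub>R b)) \<F>"
    by (intro tendsto_intros assms)
  then show ?thesis unfolding coord_expansion [symmetric] by simp
qed

text \<open>Integrating factor: each coordinate times \<open>exp (- \<mu> b * t)\<close> has zero
  derivative on the half-line, so the coordinate is a constant times a decaying exponential.\<close>

lemma continuous_decay:
  assumes td: "td = Continuous"
    and ode: "\<And>t. t \<ge> 0 \<Longrightarrow> (e has_vector_derivative M *v e t) (at t within {0..})"
  shows "(e \<longlongrightarrow> 0) at_top"
proof (rule tendsto_zero_if_coords)
  fix b assume b: "b \<in> E"
  have "((\<lambda>t. coord b (e t) * exp (- \<mu> b * t)) has_vector_derivative 0) (at t within {0..})" if "t \<ge> 0" for t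
  proof -
    have "((\<lambda>t. coord b (e t)) has_vector_derivative \<mu> b * coord b (e t)) (at t within {0..})"
      using bounded_linear.has_vector_derivative [OF bounded_linear_coord [of b] ode [OF that]]
      by (simp add: coord_mult [OF b])
    then have "((\<lambda>t. coord b (e t)) has_real_derivative \<mu> b * coord b (e t)) (at t within {0..})"
      by (simp add: has_real_derivative_iff_has_vector_derivative)
    then have "((\<lambda>t. coord b (e t) * exp (- \<mu> b * t)) has_real_derivative 0) (at t within {0..})"
      by (auto intro!: derivative_eq_intros)
    then show ?thesis by (simp add: has_real_derivative_iff_has_vector_derivative)
  qed
  then obtain c where c: "\<And>t. t \<ge> 0 \<Longrightarrow> coord b (e t) * exp (- \<mu> b * t) = c"
    using has_vector_derivative_zero_constant [of "{0..}" "\<lambda>t. coord b (e t) * exp (- \<mu> b * t)"] by auto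
  have "((\<lambda>t. c * exp (\<mu> b * t)) \<longlongrightarrow> 0) at_top"
  proof -
    have "\<mu> b < 0" using stable [OF b] td by simp
    then have "LIM t at_top. \<mu> b * t :> at_bot"
      by (intro filterlim_tendsto_neg_mult_at_bot [OF tendsto_const]) (auto simp: filterlim_ident)
    then have "((\<lambda>t. exp (\<mu> b * t)) \<longlongrightarrow> 0) at_top"
      by (rule filterlim_compose [OF exp_at_bot])
    then show ?thesis by (rule tendsto_mult_right_zero)
  qed
  moreover have "eventually (\<lambda>t. c * exp (\<mu> b * t) = coord b (e t)) at_top"
    using eventually_ge_at_top [of 0]
  proof eventually_elim
    case (elim t)
    have "c * exp (\<mu> b * t) = coord b (e t) * (exp (- \<mu> b * t) * exp (\<mu> b * t))"
      by (simp only: c [OF elim, symmetric] mult.assoc)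
    then show ?case by (simp add: exp_minus)
  qed
  ultimately show "((\<lambda>t. coord b (e t)) \<longlongrightarrow> 0) at_top" by (rule Lim_transform_eventually)
qed

lemma discrete_decay:
  assumes td: "td = Discrete" and step: "\<And>t. e (Suc t) = M *v e t"
  shows "e \<longlonglongrightarrow> 0"
proof (rule tendsto_zero_if_coords)
  fix b assume b: "b \<in> E"
  define c where "c = coord b (e 0)"
  have "coord b (e t) = \<mu> b ^ t * c" for t
    by (induction t) (simp_all add: c_def step coord_mult [OF b])
  moreover have "\<bar>\<mu> b\<bar> < 1" using stable [OF b] td by simp
  then have "(\<lambda>t. \<mu> b ^ t * c) \<longlonglongrightarrow> 0"
    by (intro tendsto_mult_left_zero LIMSEQ_power_zero) simp
  ultimately show "(\<lambda>t. coord b (e t)) \<longlonglongrightarrow> 0" by simp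
qed

end

lemma
  assumes "invertible A"
  shows matrix_inv_right: "A ** matrix_inv A = mat 1" and matrix_inv_left: "matrix_inv A ** A = mat 1"
  using someI_ex [OF assms [unfolded invertible_def]] by (simp_all add: matrix_inv_def)

text \<open>The deviation from the equilibrium for \<open>r\<close> obeys the homogeneous closed
  loop and decays; the output at the equilibrium is the static gain applied to
  \<open>G *v r\<close>, that is, \<open>r\<close>.\<close>

lemma tracks_constants_if_static_gain:
  fixes A :: "real^'n^'n" and B :: "real^'m^'n" and C :: "real^'n^'p" and D :: "real^'m^'p"
    and F :: "real^'n^'m" and G :: "real^'p^'m"
  assumes eb: "stable_eigenbasis td (A + B ** F) E \<mu>"
    and G: "closed_loop_gain td A B C D F ** G = mat 1"
  shows "tracks_constants td A B C D F G"
proof -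
  interpret stable_eigenbasis td "A + B ** F" E \<mu> by fact
  let ?M = "A + B ** F" and ?N = "C + D ** F"
  define R where "R = matrix_inv (mat (dc_point td) - ?M)"
  have R: "(mat (dc_point td) - ?M) ** R = mat 1"
    unfolding R_def by (rule matrix_inv_right [OF invertible_dc])
  \<comment> \<open>The equilibrium of the closed loop driven by the constant
    \<open>r\<close>.\<close>
  define x0 where "x0 = (\<lambda>r. R *v (B *v (G *v r)))"
  have "(mat (dc_point td) - ?M) *v x0 r = B *v (G *v r)" for r
    unfolding x0_def by (subst matrix_vector_mul_assoc) (simp add: R)
  then have x0: "dc_point td *s x0 r = ?M *v x0 r + B *v (G *v r)" for r
    by (simp add: matrix_vector_mult_diff_rdistrib mat_mult_vec algebra_simps)
  have "?N *v x0 r + D *v (G *v r) = closed_loop_gain td A B C D F *v (G *v r)" for r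
    by (simp add: closed_loop_gain_def x0_def R_def matrix_vector_mult_add_rdistrib flip: matrix_vector_mul_assoc)
  then have y0: "?N *v x0 r + D *v (G *v r) = r" for r
    by (simp add: matrix_vector_mul_assoc G)
  \<comment> \<open>The last term is zero in continuous time; in discrete time it is
    \<open>x0 r\<close>, which is subtracted again when passing to the deviation.\<close>
  have state: "A *v x + B *v (F *v x + G *v r) = ?M *v (x - x0 r) + dc_point td *s x0 r" for x r
    by (simp add: x0 matrix_vector_mult_add_rdistrib matrix_vector_right_distrib
        matrix_vector_mult_diff_distrib flip: matrix_vector_mul_assoc)
  have out: "C *v x + D *v (F *v x + G *v r) = ?N *v (x - x0 r) + r" for x r
  proof -
    have "C *v x + D *v (F *v x + G *v r) = ?N *v (x - x0 r) + (?N *v x0 r + D *v (G *v r))"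
      by (simp add: matrix_vector_mult_add_rdistrib matrix_vector_right_distrib
          matrix_vector_mult_diff_distrib flip: matrix_vector_mul_assoc)
    then show ?thesis by (simp only: y0)
  qed
  have lim: "((\<lambda>t. C *v x t + D *v (F *v x t + G *v r)) \<longlongrightarrow> r) \<F>"
    if "((\<lambda>t. x t - x0 r) \<longlongrightarrow> 0) \<F>" for x r and \<F> :: "'t filter"
  proof -
    have "bounded_linear ((*v) ?N)" by (simp add: linear_conv_bounded_linear [symmetric])
    from bounded_linear.tendsto [OF this that]
    have "((\<lambda>t. ?N *v (x t - x0 r)) \<longlongrightarrow> 0) \<F>" by simp
    then show ?thesis unfolding out by (rule tendsto_add [OF _ tendsto_const, THEN tendsto_eq_rhs]) simp
  qed
  show ?thesis
  proof (cases td)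
    case Continuous
    show ?thesis
      unfolding Continuous tracks_constants.simps
    proof (intro allI impI lim)
      fix r and x :: "real \<Rightarrow> real^'n"
      assume ode: "\<forall>t\<ge>0. (x has_vector_derivative A *v x t + B *v (F *v x t + G *v r)) (at t within {0..})"
      show "((\<lambda>t. x t - x0 r) \<longlongrightarrow> 0) at_top"
      proof (rule continuous_decay [OF Continuous])
        fix t :: real assume "t \<ge> 0"
        then have "(x has_vector_derivative ?M *v (x t - x0 r)) (at t within {0..})"
          using ode by (simp add: state Continuous)
        then show "((\<lambda>t. x t - x0 r) has_vector_derivative ?M *v (x t - x0 r)) (at t within {0..})"
          by (rule has_vector_derivative_diff [OF _ has_vector_derivative_const, simplified])
      qed
    qed
  next
    case Discrete
    show ?thesis
      unfolding Discrete tracks_constants.simps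
    proof (intro allI impI lim)
      fix r and x :: "nat \<Rightarrow> real^'n"
      assume step: "\<forall>t. x (Suc t) = A *v x t + B *v (F *v x t + G *v r)"
      show "(\<lambda>t. x t - x0 r) \<longlonglongrightarrow> 0"
        by (rule discrete_decay [OF Discrete]) (use step in \<open>simp add: state Discrete\<close>)
    qed
  qed
qed

text \<open>Full row rank at the dc point gives, for each output \<open>y\<close>, a steady state
  \<open>v\<close> and input \<open>w\<close> producing it; the feedback is compensated by the
  external input \<open>w - F v\<close>, so the gain is onto.\<close>

lemma static_gain_right_inverse:
  fixes A :: "real^'n^'n" and B :: "real^'m^'n" and C :: "real^'n^'p" and D :: "real^'m^'p"
  assumes inv: "invertible (mat (dc_point td) - (A + B ** F))"
    and full: "rank (eval_pmat (system_pencil A B C D) (of_real (dc_point td))) = CARD('n + 'p)"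
  shows "\<exists>G. closed_loop_gain td A B C D F ** G = mat 1"
proof -
  let ?s = "dc_point td" and ?M = "A + B ** F"
  let ?Q = "block_matrix (A - mat ?s) B C D"
  have "rank ?Q = CARD('n + 'p)"
    using full unfolding eval_pmat_system_pencil_of_real by (rule full_row_rank_of_cmat)
  then obtain R where R: "?Q ** R = mat 1" using full_row_rank_right_invertible by blast
  have "surj ((*v) (closed_loop_gain td A B C D F))"
    unfolding surj_def
  proof
    fix y
    obtain v w where vw: "R *v join_vec 0 y = join_vec v w" by (rule join_vec_cases)
    have "?Q *v join_vec v w = join_vec 0 y"
      by (simp add: R matrix_vector_mul_assoc flip: vw)
    then have v: "(A - mat ?s) *v v + B *v w = 0" and w: "C *v v + D *v w = y"
      by (simp_all add: block_matrix_mult_join_vec)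
    define u where "u = w - F *v v"
    have "(mat ?s - ?M) *v v = B *v u"
      using v by (simp add: u_def matrix_vector_mult_diff_rdistrib matrix_vector_mult_add_rdistrib
          matrix_vector_mult_diff_distrib algebra_simps flip: matrix_vector_mul_assoc)
    then have "matrix_inv (mat ?s - ?M) *v (B *v u) = v"
      by (metis inv matrix_inv_left matrix_vector_mul_assoc matrix_vector_mul_lid)
    then have "closed_loop_gain td A B C D F *v u = (C + D ** F) *v v + D *v u"
      by (simp add: closed_loop_gain_def matrix_vector_mult_add_rdistrib flip: matrix_vector_mul_assoc)
    also have "\<dots> = y"
      using w by (simp add: u_def matrix_vector_mult_add_rdistrib
          matrix_vector_mult_diff_distrib flip: matrix_vector_mul_assoc)
    finally show "\<exists>x. y = closed_loop_gain td A B C D F *v x" by metis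
  qed
  then show ?thesis by (simp add: matrix_right_invertible_surjective)
qed

subsection \<open>Eigenvector assignment\<close>

lemma R_hat_iff:
  "v \<in> R_hat A B C D i x \<longleftrightarrow>
     (\<exists>w \<delta>. \<delta> \<noteq> 0 \<and> A *v v + B *v w = x *s v \<and> C *v v + D *v w = \<delta> *s axis i 1)"
  by (auto simp: R_hat_def matrix_vector_mult_diff_rdistrib mat_mult_vec algebra_simps)

lemma null_directions_iff:
  "v \<in> null_directions A B C D x \<longleftrightarrow> (\<exists>w. A *v v + B *v w = x *s v \<and> C *v v + D *v w = 0)"
  by (auto simp: null_directions_def matrix_vector_mult_diff_rdistrib mat_mult_vec algebra_simps)

lemma closed_loop_mult: "(A + B ** F) *v x = A *v x + B *v (F *v x)"
  for A :: "'a::comm_semiring_1^'n^'k"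
  by (simp add: matrix_vector_mult_add_rdistrib matrix_vector_mul_assoc)

text \<open>The closed-loop eigenvectors themselves form the transversal, with the inputs
  \<open>F v\<close> as witnesses.\<close>

lemma solvable_imp_transversal:
  fixes A :: "real^'n^'n" and B :: "real^'m^'n" and C :: "real^'n^'p" and D :: "real^'m^'p"
    and \<nu> :: "'p \<Rightarrow> nat" and l :: "'p \<Rightarrow> nat \<Rightarrow> real"
  defines "J \<equiv> (SIGMA k:UNIV. {1..case_option (CARD('n) - (\<Sum>i\<in>UNIV. \<nu> i)) \<nu> k})"
  assumes "problem_2B_solvable td A B C D \<nu> l"
  shows "\<exists>v. inj_on v J \<and> independent (v ` J) \<and>
    (\<forall>j. (None, j) \<in> J \<longrightarrow> v (None, j) \<in> stable_null_directions td A B C D) \<and>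
    (\<forall>i j. (Some i, j) \<in> J \<longrightarrow> v (Some i, j) \<in> R_hat A B C D i (l i j))"
proof -
  obtain F :: "real^'n^'m" and \<mu>0 where spec: "spectrum (A + B ** F) \<subseteq> stable_region td"
    and dec: "output_decoupled (A + B ** F) (C + D ** F)
        (case_option (CARD('n) - (\<Sum>i\<in>UNIV. \<nu> i)) \<nu>) (case_option \<mu>0 l)"
    using assms(2) unfolding problem_2B_solvable_def by blast
  define \<mu> where "\<mu> = case_option \<mu>0 l"
  obtain u where "let w = (\<lambda>(k, j). u k j) in
       inj_on w J \<and> independent (w ` J) \<and> span (w ` J) = UNIV \<and>
       (\<forall>(k, j)\<in>J. (A + B ** F) *v u k j = \<mu> k j *s u k j) \<and>
       (\<forall>j\<in>{1..CARD('n) - (\<Sum>i\<in>UNIV. \<nu> i)}. (C + D ** F) *v u None j = 0) \<and>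
       (\<forall>i. \<forall>j\<in>{1..\<nu> i}. \<exists>\<delta>. \<delta> \<noteq> 0 \<and> (C + D ** F) *v u (Some i) j = \<delta> *s axis i 1)"
    using dec unfolding output_decoupled_def J_def \<mu>_def Let_def option.case by blast
  note u = this [unfolded Let_def]
  define v where "v = (\<lambda>(k, j). u k j)"
  have inj: "inj_on v J" and ind: "independent (v ` J)" using u unfolding v_def by blast+
  have eig: "A *v v (k, j) + B *v (F *v v (k, j)) = \<mu> k j *s v (k, j)" if "(k, j) \<in> J" for k j
    using u that unfolding v_def by (auto simp: closed_loop_mult)
  \<comment> \<open>The eigenvalue of an unobservable mode is not prescribed, so its stability must
    be read off from the closed-loop spectrum; this requires a nonzero eigenvector, supplied by
    independence.\<close>
  have "v (None, j) \<in> stable_null_directions td A B C D" if j: "(None, j) \<in> J" for j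
  proof -
    let ?x = "v (None, j)"
    have "?x \<noteq> 0" using ind j by (metis dependent_zero imageI)
    have "cmat (A + B ** F) *v cvec ?x = of_real (\<mu> None j) *s cvec ?x"
      unfolding cmat_mult_cvec closed_loop_mult eig [OF j] by (simp add: cvec_def vec_eq_iff)
    moreover have "cvec ?x \<in> complexification UNIV" by (simp add: complexification_def)
    ultimately have "of_real (\<mu> None j) \<in> spectrum (A + B ** F)"
      using \<open>?x \<noteq> 0\<close> unfolding spectrum_def spectrum_on_eq by (metis cvec_eq_0_iff)
    then have "of_real (\<mu> None j) \<in> stable_region td" using spec by blast
    moreover have "C *v ?x + D *v (F *v ?x) = 0"
      using u j unfolding v_def J_def by (simp add: closed_loop_mult)
    ultimately show ?thesis
      using eig [OF j] unfolding stable_null_directions_def null_directions_iff UN_iff by blast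
  qed
  moreover have "v (Some i, j) \<in> R_hat A B C D i (l i j)" if ij: "(Some i, j) \<in> J" for i j
  proof -
    have "j \<in> {1..\<nu> i}" using ij by (simp add: J_def)
    then have "\<exists>\<delta>. \<delta> \<noteq> 0 \<and> (C + D ** F) *v v (Some i, j) = \<delta> *s axis i 1"
      using u unfolding v_def by simp
    moreover have "\<mu> (Some i) j = l i j" by (simp add: \<mu>_def)
    ultimately show ?thesis
      using eig [OF ij] unfolding R_hat_iff closed_loop_mult by metis
  qed
  ultimately show ?thesis using inj ind by blast
qed

text \<open>As the chosen directions form a basis, prescribing their inputs determines a feedback
  that makes all of them eigenvectors at once.\<close>

lemma transversal_imp_solvable:
  fixes A :: "real^'n^'n" and B :: "real^'m^'n" and C :: "real^'n^'p" and D :: "real^'m^'p"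
    and \<nu> :: "'p \<Rightarrow> nat" and l :: "'p \<Rightarrow> nat \<Rightarrow> real"
  defines "J \<equiv> (SIGMA k:UNIV. {1..case_option (CARD('n) - (\<Sum>i\<in>UNIV. \<nu> i)) \<nu> k})"
  assumes ri: "right_invertible A B C D"
    and dc: "\<not> invariant_zero A B C D (of_real (dc_point td))"
    and stable: "\<And>i j. j \<in> {1..\<nu> i} \<Longrightarrow> complex_of_real (l i j) \<in> stable_region td"
    and inj: "inj_on v J" and ind: "independent (v ` J)" and span: "span (v ` J) = UNIV"
    and None: "\<And>j. (None, j) \<in> J \<Longrightarrow> v (None, j) \<in> stable_null_directions td A B C D"
    and Some: "\<And>i j. (Some i, j) \<in> J \<Longrightarrow> v (Some i, j) \<in> R_hat A B C D i (l i j)"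
  shows "problem_2B_solvable td A B C D \<nu> l"
proof -
  \<comment> \<open>Collects for each index an eigenvalue \<open>x\<close> and an input
    \<open>w\<close>; \<open>x\<close> is forced for observable modes and free for the
    others.\<close>
  define good where "good = (\<lambda>k (x, w). complex_of_real x \<in> stable_region td \<and>
    A *v v k + B *v w = x *s v k \<and>
    (case k of (None, j) \<Rightarrow> C *v v k + D *v w = 0
     | (Some i, j) \<Rightarrow> x = l i j \<and> (\<exists>\<delta>. \<delta> \<noteq> 0 \<and> C *v v k + D *v w = \<delta> *s axis i 1)))"
  have "\<exists>p. good k p" if "k \<in> J" for k
  proof (cases k)
    case (Pair o' j)
    show ?thesis
    proof (cases o')
      case None': None
      then have "v (None, j) \<in> stable_null_directions td A B C D" using None that Pair by simp
      then show ?thesis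
        unfolding stable_null_directions_def null_directions_iff UN_iff good_def Pair None' by auto
    next
      case Some': (Some i)
      then have "v (Some i, j) \<in> R_hat A B C D i (l i j)" using Some that Pair by simp
      moreover have "complex_of_real (l i j) \<in> stable_region td"
        using that by (intro stable) (simp add: J_def Pair Some')
      ultimately show ?thesis
        unfolding R_hat_iff good_def Pair Some' by auto
    qed
  qed
  then obtain p where p: "\<And>k. k \<in> J \<Longrightarrow> good k (p k)" by metis
  define \<mu> where "\<mu> = (\<lambda>k. fst (p k))"
  define w where "w = (\<lambda>k. snd (p k))"
  have good: "good k (\<mu> k, w k)" if "k \<in> J" for k using p [OF that] by (simp add: \<mu>_def w_def)
  \<comment> \<open>Eigenvalues and inputs are indexed by \<open>J\<close>; injectivity of
    \<open>v\<close> lets them be read as functions of the basis vectors.\<close>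
  let ?i = "inv_into J v"
  obtain f where f: "linear f" "\<forall>b\<in>v ` J. f b = w (?i b)"
    using linear_independent_extend [OF ind, of "\<lambda>b. w (?i b)"] by blast
  define F where "F = matrix f"
  have F: "F *v v k = w k" if "k \<in> J" for k
    using f that by (simp add: F_def matrix_works inv_into_f_f [OF inj])
  have eig: "(A + B ** F) *v v k = \<mu> k *s v k" if "k \<in> J" for k
    using good [OF that] by (simp add: good_def closed_loop_mult F that)
  have eb: "stable_eigenbasis td (A + B ** F) (v ` J) (\<lambda>b. \<mu> (?i b))"
  proof
    fix b assume "b \<in> v ` J"
    then obtain k where k: "k \<in> J" "b = v k" by blast
    show "(A + B ** F) *v b = \<mu> (?i b) *s b"
      by (simp add: k eig inv_into_f_f [OF inj])
    show "complex_of_real (\<mu> (?i b)) \<in> stable_region td"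
      using good [OF k(1)] by (simp add: k inv_into_f_f [OF inj] good_def)
  qed (fact ind span)+
  have "rank (eval_pmat (system_pencil A B C D) (of_real (dc_point td))) = CARD('n + 'p)"
    using dc invariant_zero_iff [OF ri] by blast
  then obtain G where G: "closed_loop_gain td A B C D F ** G = mat 1"
    using static_gain_right_inverse [OF stable_eigenbasis.invertible_dc [OF eb]] by blast
  have "output_decoupled (A + B ** F) (C + D ** F)
        (case_option (CARD('n) - (\<Sum>i\<in>UNIV. \<nu> i)) \<nu>) (case_option (\<lambda>j. \<mu> (None, j)) l)"
    unfolding output_decoupled_def Let_def J_def [symmetric]
  proof (intro exI [of _ "curry v"] conjI)
    have [simp]: "(\<lambda>(k, j). curry v k j) = v" by auto
    show "inj_on (\<lambda>(k, j). curry v k j) J" "independent ((\<lambda>(k, j). curry v k j) ` J)"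
      "span ((\<lambda>(k, j). curry v k j) ` J) = UNIV"
      using inj ind span by simp_all
    show "\<forall>(k, j)\<in>J. (A + B ** F) *v curry v k j =
        (case k of None \<Rightarrow> \<lambda>j. \<mu> (None, j) | Some x \<Rightarrow> l x) j *s curry v k j"
    proof clarify
      fix k j assume kj: "(k, j) \<in> J"
      show "(A + B ** F) *v curry v k j =
        (case k of None \<Rightarrow> \<lambda>j. \<mu> (None, j) | Some x \<Rightarrow> l x) j *s curry v k j"
        using eig [OF kj] good [OF kj] by (cases k) (auto simp: good_def)
    qed
    show "\<forall>j\<in>{1..case None of None \<Rightarrow> CARD('n) - (\<Sum>i\<in>UNIV. \<nu> i) | Some x \<Rightarrow> \<nu> x}.
        (C + D ** F) *v curry v None j = 0"
    proof
      fix j assume "j \<in> {1..case None of None \<Rightarrow> CARD('n) - (\<Sum>i\<in>UNIV. \<nu> i) | Some x \<Rightarrow> \<nu> x}"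
      then have j: "(None, j) \<in> J" by (simp add: J_def)
      show "(C + D ** F) *v curry v None j = 0"
        using good [OF j] by (simp add: good_def closed_loop_mult F j)
    qed
    show "\<forall>i. \<forall>j\<in>{1..case Some i of None \<Rightarrow> CARD('n) - (\<Sum>i\<in>UNIV. \<nu> i) | Some x \<Rightarrow> \<nu> x}.
        \<exists>\<delta>. \<delta> \<noteq> 0 \<and> (C + D ** F) *v curry v (Some i) j = \<delta> *s axis i 1"
    proof (intro allI ballI)
      fix i j assume "j \<in> {1..case Some i of None \<Rightarrow> CARD('n) - (\<Sum>i\<in>UNIV. \<nu> i) | Some x \<Rightarrow> \<nu> x}"
      then have j: "(Some i, j) \<in> J" by (simp add: J_def)
      show "\<exists>\<delta>. \<delta> \<noteq> 0 \<and> (C + D ** F) *v curry v (Some i) j = \<delta> *s axis i 1"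
        using good [OF j] by (simp add: good_def closed_loop_mult F j)
    qed
  qed
  then show ?thesis
    unfolding problem_2B_solvable_def
    using stable_eigenbasis.spectrum_stable [OF eb] G tracks_constants_if_static_gain [OF eb G] by blast
qed

theorem theorem15:
  fixes td :: time_domain
    and A :: "real^'n^'n" and B :: "real^'m^'n" and C :: "real^'n^'p" and D :: "real^'m^'p"
    and \<nu> :: "'p \<Rightarrow> nat" and l :: "'p \<Rightarrow> nat \<Rightarrow> real"
  defines "I \<equiv> (SIGMA i:UNIV. {1..\<nu> i})"
    and "\<nu>\<^sub>0 \<equiv> CARD('n) - (\<Sum>i\<in>UNIV. \<nu> i)"
  assumes "right_invertible A B C D"
    and "stabilizable td A B"
    and "\<not> invariant_zero A B C D (of_real (dc_point td))"
    and "\<And>z. invariant_zero A B C D z \<Longrightarrow> z \<in> stable_region td \<Longrightarrow>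
           zero_alg_mult (system_pencil A B C D) z = zero_geom_mult (system_pencil A B C D) z"
    and "\<And>z. invariant_zero A B C D z \<Longrightarrow> z \<in> stable_region td \<Longrightarrow> z \<in> \<real>"
    and "(\<Sum>i\<in>UNIV. \<nu> i) \<le> CARD('n)"
    and "\<And>i j. j \<in> {1..\<nu> i} \<Longrightarrow> complex_of_real (l i j) \<in> stable_region td"
  shows "problem_2B_solvable td A B C D \<nu> l \<longleftrightarrow>
    (\<forall>P \<in> Pow I.
       dim (V_star_g td A B C D + (\<Sum>(i, j)\<in>P. span (R_hat A B C D i (l i j)))) \<ge> card P + \<nu>\<^sub>0 \<and>
       dim (\<Sum>(i, j)\<in>P. span (R_hat A B C D i (l i j))) \<ge> card P)"
proof -
  define N where "N = stable_null_directions td A B C D"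
  define R where "R = (\<lambda>(i, j). R_hat A B C D i (l i j))"
  \<comment> \<open>\<open>I\<close> enlarged by \<open>\<nu>\<^sub>0\<close> extra indices, each of
    which will stand for one copy of \<open>N\<close>.\<close>
  define J where "J = (SIGMA k:UNIV. {1..case_option (CARD('n) - (\<Sum>i\<in>UNIV. \<nu> i)) \<nu> k})"
  let ?s = "\<lambda>(i :: 'p, j :: nat). (Some i, j)"
  have J_None: "(None, j) \<in> J \<longleftrightarrow> j \<in> {1..\<nu>\<^sub>0}" for j by (simp add: J_def \<nu>\<^sub>0_def)
  have J_Some: "(Some i, j) \<in> J \<longleftrightarrow> (i, j) \<in> I" for i j by (simp add: J_def I_def)
  have s_image: "(k, j) \<in> ?s ` X \<longleftrightarrow> (\<exists>i. k = Some i \<and> (i, j) \<in> X)" for k j X by force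
  have J_eq: "J = Pair None ` {1..\<nu>\<^sub>0} \<union> ?s ` I"
  proof (rule set_eqI)
    fix k show "k \<in> J \<longleftrightarrow> k \<in> Pair None ` {1..\<nu>\<^sub>0} \<union> ?s ` I"
      by (cases k; cases "fst k") (auto simp: J_None J_Some s_image)
  qed
  have finI: "finite I" by (simp add: I_def)
  have finJ: "finite J" using finI by (simp add: J_eq)
  have card_s: "card (?s ` X) = card X" for X by (rule card_image) (auto simp: inj_on_def)
  have card_Un: "card (Pair None ` {1..\<nu>\<^sub>0} \<union> ?s ` P) = card P + \<nu>\<^sub>0" if "finite P" for P :: "('p \<times> nat) set"
    using that by (subst card_Un_disjoint) (auto simp: card_s card_image inj_on_def)
  have "card I = (\<Sum>i\<in>UNIV. \<nu> i)" by (simp add: I_def)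
  \<comment> \<open>The bound on the sum of the \<open>\<nu> i\<close> keeps the natural-number
    subtraction in \<open>\<nu>\<^sub>0\<close> from being truncated.\<close>
  then have cardJ: "card J = CARD('n)"
    using assms(8) card_Un [OF finI] unfolding J_eq \<nu>\<^sub>0_def by linarith
  have zeros: "real_semisimple_stable_zeros td A B C D"
    using assms(6,7) unfolding real_semisimple_stable_zeros_def by blast
  have V: "V_star_g td A B C D = span N"
    unfolding N_def by (rule V_star_g_eq [OF assms(3) zeros])
  have sum_R: "(\<Sum>(i, j)\<in>P. span (R_hat A B C D i (l i j))) = span (\<Union>p\<in>P. R p)" if "P \<subseteq> I" for P
  proof -
    have "(\<Sum>(i, j)\<in>P. span (R_hat A B C D i (l i j))) = (\<Sum>p\<in>P. span (R p))"
      by (rule sum.cong) (auto simp: R_def)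
    then show ?thesis using finite_subset [OF that finI] by (simp add: sum_span)
  qed
  have "(\<forall>P \<in> Pow I.
       dim (V_star_g td A B C D + (\<Sum>(i, j)\<in>P. span (R_hat A B C D i (l i j)))) \<ge> card P + \<nu>\<^sub>0 \<and>
       dim (\<Sum>(i, j)\<in>P. span (R_hat A B C D i (l i j))) \<ge> card P) \<longleftrightarrow>
    (\<forall>P \<in> Pow I. card P + \<nu>\<^sub>0 \<le> dim (N \<union> (\<Union>p\<in>P. R p)) \<and> card P \<le> dim (\<Union>p\<in>P. R p))"
    by (intro ball_cong refl) (simp add: V sum_R span_plus_span)
  also have "\<dots> \<longleftrightarrow> problem_2B_solvable td A B C D \<nu> l"
  proof
    assume "problem_2B_solvable td A B C D \<nu> l"
    then obtain v where v: "inj_on v J" "independent (v ` J)"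
      "\<And>j. (None, j) \<in> J \<Longrightarrow> v (None, j) \<in> N"
      "\<And>i j. (Some i, j) \<in> J \<Longrightarrow> v (Some i, j) \<in> R_hat A B C D i (l i j)"
      using solvable_imp_transversal [of td A B C D \<nu> l] unfolding J_def N_def by blast
    \<comment> \<open>Necessity is a count of independent vectors: those indexed by \<open>P\<close>
      give the second inequality, and those with all \<open>None\<close> indices added give the
      first.\<close>
    have card_le: "card T \<le> dim X" if "T \<subseteq> J" "v ` T \<subseteq> X" for T X
    proof -
      have "independent (v ` T)" using v(2) that(1) by (metis image_mono independent_mono)
      then have "card (v ` T) \<le> dim X" by (rule independent_card_le_dim [OF that(2)])
      moreover have "card (v ` T) = card T"
        using v(1) that(1) by (metis card_image inj_on_subset)
      ultimately show ?thesis by simp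
    qed
    show "\<forall>P \<in> Pow I. card P + \<nu>\<^sub>0 \<le> dim (N \<union> (\<Union>p\<in>P. R p)) \<and> card P \<le> dim (\<Union>p\<in>P. R p)"
    proof (intro ballI conjI)
      fix P assume "P \<in> Pow I"
      then have P: "P \<subseteq> I" by simp
      have R: "v ` ?s ` P \<subseteq> (\<Union>p\<in>P. R p)"
      proof clarsimp
        fix i j assume "(i, j) \<in> P"
        then show "\<exists>p\<in>P. v (Some i, j) \<in> R p"
          using v(4) P J_Some by (intro bexI [of _ "(i, j)"]) (auto simp: R_def)
      qed
      have "card (?s ` P) \<le> dim (\<Union>p\<in>P. R p)"
        by (rule card_le [OF _ R]) (use P in \<open>auto simp: J_eq\<close>)
      then show "card P \<le> dim (\<Union>p\<in>P. R p)" by (simp add: card_s)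
      have "card (Pair None ` {1..\<nu>\<^sub>0} \<union> ?s ` P) \<le> dim (N \<union> (\<Union>p\<in>P. R p))"
      proof (rule card_le)
        show "Pair None ` {1..\<nu>\<^sub>0} \<union> ?s ` P \<subseteq> J" using P by (auto simp: J_eq)
        have "v ` Pair None ` {1..\<nu>\<^sub>0} \<subseteq> N" using v(3) J_None by auto
        then show "v ` (Pair None ` {1..\<nu>\<^sub>0} \<union> ?s ` P) \<subseteq> N \<union> (\<Union>p\<in>P. R p)"
          using R unfolding image_Un by (rule Un_mono)
      qed
      then show "card P + \<nu>\<^sub>0 \<le> dim (N \<union> (\<Union>p\<in>P. R p))"
        by (simp only: card_Un [OF finite_subset [OF P finI]])
    qed
  next
    assume rank: "\<forall>P \<in> Pow I. card P + \<nu>\<^sub>0 \<le> dim (N \<union> (\<Union>p\<in>P. R p)) \<and> card P \<le> dim (\<Union>p\<in>P. R p)"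
    define \<A> where "\<A> = (\<lambda>(k, j). case k of None \<Rightarrow> N | Some i \<Rightarrow> R (i, j))"
    have "card T \<le> dim (\<Union>k\<in>T. \<A> k)" if T: "T \<subseteq> J" for T
    proof -
      define P where "P = {(i, j). (Some i, j) \<in> T}"
      have P: "P \<subseteq> I" using T J_Some by (auto simp: P_def)
      then have finP: "finite P" using finI by (rule finite_subset)
      have R: "(\<Union>p\<in>P. R p) \<subseteq> (\<Union>k\<in>T. \<A> k)"
        by (fastforce simp: P_def \<A>_def)
      show ?thesis
      proof (cases "\<exists>j. (None, j) \<in> T")
        \<comment> \<open>The union contains \<open>N\<close>. Adding all
          \<open>\<nu>\<^sub>0\<close> copies of \<open>N\<close> leaves the union unchanged and
          only enlarges the index set, so the first inequality suffices.\<close>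
        case True
        have "T \<subseteq> Pair None ` {1..\<nu>\<^sub>0} \<union> ?s ` P"
        proof
          fix k assume "k \<in> T"
          then show "k \<in> Pair None ` {1..\<nu>\<^sub>0} \<union> ?s ` P"
            using T J_None by (cases k; cases "fst k") (auto simp: P_def s_image)
        qed
        then have "card T \<le> card P + \<nu>\<^sub>0"
          using finP card_mono by (metis card_Un finite_UnI finite_imageI finite_atLeastAtMost)
        also have "\<dots> \<le> dim (N \<union> (\<Union>p\<in>P. R p))" using rank P by blast
        also have "\<dots> \<le> dim (\<Union>k\<in>T. \<A> k)"
          using True R by (intro dim_subset) (force simp: \<A>_def)
        finally show ?thesis .
      next
        \<comment> \<open>Only sets \<open>R\<close> occur, so the second inequality
          applies.\<close>
        case False
        have "T \<subseteq> ?s ` P"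
        proof
          fix k assume "k \<in> T"
          then show "k \<in> ?s ` P"
            using False by (cases k; cases "fst k") (auto simp: P_def s_image)
        qed
        then have "card T \<le> card (?s ` P)" by (intro card_mono) (simp add: finP)
        also have "\<dots> = card P" by (simp add: card_s)
        also have "\<dots> \<le> dim (\<Union>p\<in>P. R p)" using rank P by blast
        also have "\<dots> \<le> dim (\<Union>k\<in>T. \<A> k)" by (rule dim_subset [OF R])
        finally show ?thesis .
      qed
    qed
    then obtain v where v: "\<And>k. k \<in> J \<Longrightarrow> v k \<in> \<A> k" "inj_on v J" "independent (v ` J)"
      using Rado_transversal [OF finJ] by metis
    \<comment> \<open>An independent family of \<open>n\<close> vectors is a basis of the state
      space.\<close>
    have "card (v ` J) = DIM(real^'n)" using cardJ v(2) by (simp add: card_image)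
    then have "span (v ` J) = UNIV"
      using v(3) by (metis dim_eq_card_independent dim_eq_full)
    moreover have "v (None, j) \<in> stable_null_directions td A B C D" if "(None, j) \<in> J" for j
      using v(1) [OF that] by (simp add: \<A>_def N_def)
    moreover have "v (Some i, j) \<in> R_hat A B C D i (l i j)" if "(Some i, j) \<in> J" for i j
      using v(1) [OF that] by (simp add: \<A>_def R_def)
    ultimately show "problem_2B_solvable td A B C D \<nu> l"
      using v(2,3) unfolding J_def by (intro transversal_imp_solvable [OF assms(3,5,9)])
  qed
  finally show ?thesis by blast
qed

end
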